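(* For $\alpha\in(0,1)$ consider the Manneville–Pomeau map $f_\alpha:[0,1]\to[0,1]$, $f_\alpha(x)=x+x^{1+\alpha}\pmod 1$. For any $b<-\log 2$ there exists a Hölder continuous potential $\phi:[0,1]\to\mathbb{R}$ with $\sup\phi-\inf\phi=|b|$, which has the form $\phi(x)=-2\alpha x^\alpha$ for $x$ close to $0$, and which has no equilibrium state compatible with any of the first-return inducing schemes described in the context.
   Context: Write $I=[0,1]$, $f=f_\alpha$. $\mathcal{M}_{erg}$ is the set of ergodic $f$-invariant Borel probability measures, $P(\phi)=\sup\{h_\nu(f)+\int\phi\,d\nu:\nu\in\mathcal{M}_{erg},\ -\int\phi\,d\nu<\infty\}$, and an equilibrium state for $\phi$ is a measure attaining this supremum. $\mathcal{P}_1$ is the partition of $I$ into maximal intervals of monotonicity (branches) of $f$, $\mathcal{P}_n=\bigvee_{i=0}^{n-1}f^{-i}(\mathcal{P}_1)$, $\mathcal{P}_0=\{I\}$. An inducing scheme $(X,F,\tau)$ over $(I,f)$ consists of an interval $X\subset I$ containing a countable collection of disjoint subintervals $X_i$, and a function $\tau:\bigcup_iX_i\to\mathbb{N}$ with $\tau|_{X_i}\equiv\tau_i$ constant, such that $F|_{X_i}=f^{\tau_i}|_{X_i}$ is a homeomorphism of $X_i$ onto $X$. With $X^\infty=\bigcap_nF^{-n}(\bigcup_iX_i)$, a measure $\mu$ is compatible with $(X,F,\tau)$ if $\mu(X)>0$, $\mu(X\setminus X^\infty)=0$ and there is an $F$-invariant probability measure $\mu_F$ with $\Lambda:=\int_X\tau\,d\mu_F<\infty$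 and $\mu(A)=\frac1\Lambda\sum_i\sum_{k=0}^{\tau_i-1}\mu_F(X_i\cap f^{-k}(A))$ for all measurable $A$. Hofbauer tower: $\hat I=\bigsqcup_{n\ge0}\bigsqcup_{C\in\mathcal{P}_n}f^n(C)/\sim$, where $f^n(C)\sim f^m(C')$ if they represent the same interval. The intervals $D=f^n(C)$ are called domains and $\mathcal{D}$ is the set of domains. Points of $\hat I$ are pairs $(x,D)$ with $x\in D\in\mathcal{D}$; $\pi(x,D)=x$. The map is $\hat f(x,D)=(f(x),D')$ if there are cylinders $C_n\supset C_{n+1}$ (in $\mathcal{P}_n$, $\mathcal{P}_{n+1}$) with $x\in f^n(C_{n+1})\subset f^n(C_n)=D$ and $D'=f^{n+1}(C_{n+1})$; then one writes $D\to D'$. $\hat I_{\rm trans}=\bigsqcup_{D\in\mathcal{E}}D$, where $(\mathcal{E},\to)$ is the closed primitive subgraph of $(\mathcal{D},\to)$ containing a dense $\hat f$-orbit and with $I=\pi(\bigcup_{D\in\mathcal{E}}D)$. First-return inducing schemes: take $\hat X\subset\hat I_{\rm trans}$ an element of the partition $\pi^{-1}(\mathcal{P}_N)\vee\mathcal{D}$ for some $N$, compactly contained in its domain $D$. Put $X=\pi(\hat X)\in\mathcal{P}_N$; for $x=\pi(\hat x)$ with $\hat x\in\hat X$ let $\tau(x)$ be the first return time of $\hat x$ to $\hat X$ under $\hat f$, and $F(x)=f^{\tau(x)}(x)$, the $X_i$ being the branch domains of $F$. *)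

theory Defs
  imports "HOL-Probability.Probability"
begin

section \<open>Partitions\<close>

definition join :: "'a set set \<Rightarrow> 'a set set \<Rightarrow> 'a set set" where
  "join P Q = {A \<inter> B | A B. A \<in> P \<and> B \<in> Q} - {{}}"

text \<open>\<open>refinement S T P n\<close> is the join of \<open>P, T\<^sup>-\<^sup>1 P, \<dots>\<close> up to the preimage under the
  iterate of order \<open>n - 1\<close>, as a partition of \<open>S\<close>.\<close>

primrec refinement :: "'a set \<Rightarrow> ('a \<Rightarrow> 'a) \<Rightarrow> 'a set set \<Rightarrow> nat \<Rightarrow> 'a set set" where
  "refinement S T P 0 = {S}"
| "refinement S T P (Suc n) =
     join (refinement S T P n) ((\<lambda>A. (T ^^ n) -` A \<inter> S) ` P)"

section \<open>Entropy, pressure and equilibrium states\<close>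

definition partition_entropy :: "'a measure \<Rightarrow> 'a set set \<Rightarrow> real" where
  "partition_entropy M P = (\<Sum>A\<in>P. - (measure M A * ln (measure M A)))"

text \<open>For an invariant probability measure the sequence below converges (subadditivity), so
  that \<open>limsup\<close> is the limit.\<close>

definition entropy_wrt_partition :: "'a measure \<Rightarrow> ('a \<Rightarrow> 'a) \<Rightarrow> 'a set set \<Rightarrow> ereal" where
  "entropy_wrt_partition M T P =
     limsup (\<lambda>n. ereal (partition_entropy M (refinement (space M) T P n) / real n))"

definition ks_entropy :: "'a measure \<Rightarrow> ('a \<Rightarrow> 'a) \<Rightarrow> ereal" where
  "ks_entropy M T =
     (SUP P \<in> {P. finite P \<and> P \<subseteq> sets M \<and> partition_on (space M) P}.
        entropy_wrt_partition M T P)"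

abbreviation I01 :: "real set" where "I01 \<equiv> {0..1}"

definition ergodic_measures :: "(real \<Rightarrow> real) \<Rightarrow> real measure set" where
  "ergodic_measures f = {M. sets M = sets (restrict_space borel I01) \<and> prob_space M
     \<and> f \<in> measurable M M \<and> distr M M f = M
     \<and> (\<forall>A\<in>sets M. f -` A \<inter> space M = A \<longrightarrow> emeasure M A = 0 \<or> emeasure M A = 1)}"

definition free_energy :: "(real \<Rightarrow> real) \<Rightarrow> (real \<Rightarrow> real) \<Rightarrow> real measure \<Rightarrow> ereal" where
  "free_energy f \<phi> M = ks_entropy M f + ereal (\<integral>x. \<phi> x \<partial>M)"

text \<open>For a potential that is bounded above, integrability is the condition that minus the
  integral is smaller than infinity.\<close>

definition pressure :: "(real \<Rightarrow> real) \<Rightarrow> (real \<Rightarrow> real) \<Rightarrow> ereal" where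
  "pressure f \<phi> = (SUP M \<in> {M \<in> ergodic_measures f. integrable M \<phi>}. free_energy f \<phi> M)"

definition equilibrium_state :: "(real \<Rightarrow> real) \<Rightarrow> (real \<Rightarrow> real) \<Rightarrow> real measure \<Rightarrow> bool" where
  "equilibrium_state f \<phi> M \<longleftrightarrow>
     M \<in> ergodic_measures f \<and> integrable M \<phi> \<and> free_energy f \<phi> M = pressure f \<phi>"

section \<open>Branches and inducing schemes\<close>

definition branch_on :: "(real \<Rightarrow> real) \<Rightarrow> real set \<Rightarrow> bool" where
  "branch_on g J \<longleftrightarrow> J \<noteq> {} \<and> is_interval J \<and> continuous_on J g \<and> (mono_on J g \<or> antimono_on J g)"

text \<open>Maximal intervals of monotonicity of \<open>g\<close> inside \<open>S\<close>.\<close>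

definition branches :: "(real \<Rightarrow> real) \<Rightarrow> real set \<Rightarrow> real set set" where
  "branches g S = {J. J \<subseteq> S \<and> branch_on g J \<and>
     (\<forall>J'. J' \<subseteq> S \<and> branch_on g J' \<and> J \<subseteq> J' \<longrightarrow> J' = J)}"

definition cylinders :: "(real \<Rightarrow> real) \<Rightarrow> nat \<Rightarrow> real set set" where
  "cylinders f n = refinement I01 f (branches f I01) n"

definition induced_map :: "(real \<Rightarrow> real) \<Rightarrow> (real \<Rightarrow> nat) \<Rightarrow> real \<Rightarrow> real" where
  "induced_map f \<tau> x = (f ^^ \<tau> x) x"

text \<open>The collection of the intervals \<open>X\<^sub>i\<close> is the set \<open>\<X>\<close>. The values of \<open>\<tau>\<close> matter on
  \<open>\<Union>\<X>\<close> only; \<open>the_elem (\<tau> ` J)\<close> is its constant value on \<open>J \<in> \<X>\<close>.\<close>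

definition inducing_scheme ::
    "(real \<Rightarrow> real) \<Rightarrow> real set \<Rightarrow> real set set \<Rightarrow> (real \<Rightarrow> nat) \<Rightarrow> bool" where
  "inducing_scheme f X \<X> \<tau> \<longleftrightarrow>
     is_interval X \<and> X \<noteq> {} \<and> X \<subseteq> I01 \<and> countable \<X> \<and> disjoint \<X> \<and>
     (\<forall>J\<in>\<X>. is_interval J \<and> J \<subseteq> X \<and>
        (\<exists>t\<ge>1. (\<forall>x\<in>J. \<tau> x = t) \<and> (\<exists>g. homeomorphism J X (f ^^ t) g)))"

definition scheme_core ::
    "(real \<Rightarrow> real) \<Rightarrow> real set set \<Rightarrow> (real \<Rightarrow> nat) \<Rightarrow> real set" where
  "scheme_core f \<X> \<tau> = {x. \<forall>n. (induced_map f \<tau> ^^ n) x \<in> \<Union>\<X>}"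

text \<open>The induced map is defined on \<open>\<Union>\<X>\<close> only, so invariance is stated with the preimage
  inside \<open>\<Union>\<X>\<close>; for \<open>A = X\<close> this gives the complement of \<open>\<Union>\<X>\<close> measure zero.\<close>

definition induced_invariant ::
    "(real \<Rightarrow> real) \<Rightarrow> real set \<Rightarrow> real set set \<Rightarrow> (real \<Rightarrow> nat) \<Rightarrow> real measure \<Rightarrow> bool" where
  "induced_invariant f X \<X> \<tau> M \<longleftrightarrow>
     sets M = sets (restrict_space borel X) \<and> prob_space M \<and>
     (\<forall>A\<in>sets M. emeasure M {x \<in> \<Union>\<X>. induced_map f \<tau> x \<in> A} = emeasure M A)"

definition compatible ::
    "(real \<Rightarrow> real) \<Rightarrow> real set \<Rightarrow> real set set \<Rightarrow> (real \<Rightarrow> nat) \<Rightarrow> real measure \<Rightarrow> bool" where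
  "compatible f X \<X> \<tau> \<mu> \<longleftrightarrow>
     emeasure \<mu> X > 0 \<and> emeasure \<mu> (X - scheme_core f \<X> \<tau>) = 0 \<and>
     (\<exists>\<mu>\<^sub>F \<Lambda>. induced_invariant f X \<X> \<tau> \<mu>\<^sub>F \<and>
        \<Lambda> = (\<integral>\<^sup>+x\<in>\<Union>\<X>. of_nat (\<tau> x) \<partial>\<mu>\<^sub>F) \<and> \<Lambda> < \<infinity> \<and>
        (\<forall>A\<in>sets \<mu>. emeasure \<mu> A =
           (\<Sum>\<^sub>\<infinity>J\<in>\<X>. \<Sum>k<the_elem (\<tau> ` J). emeasure \<mu>\<^sub>F (J \<inter> (f ^^ k) -` A)) / \<Lambda>))"

section \<open>The Hofbauer tower\<close>

definition domains :: "(real \<Rightarrow> real) \<Rightarrow> real set set" where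
  "domains f = {(f ^^ n) ` C | n C. C \<in> cylinders f n}"

definition tower_over :: "real set set \<Rightarrow> (real \<times> real set) set" where
  "tower_over \<E> = {(x, D). D \<in> \<E> \<and> x \<in> D}"

definition edge :: "(real \<Rightarrow> real) \<Rightarrow> real set \<Rightarrow> real set \<Rightarrow> bool" where
  "edge f D D' \<longleftrightarrow> (\<exists>n C C'. C \<in> cylinders f n \<and> C' \<in> cylinders f (Suc n) \<and> C' \<subseteq> C \<and>
     D = (f ^^ n) ` C \<and> D' = (f ^^ Suc n) ` C')"

definition edge_at :: "(real \<Rightarrow> real) \<Rightarrow> real \<Rightarrow> real set \<Rightarrow> real set \<Rightarrow> bool" where
  "edge_at f x D D' \<longleftrightarrow> (\<exists>n C C'. C \<in> cylinders f n \<and> C' \<in> cylinders f (Suc n) \<and> C' \<subseteq> C \<and>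
     x \<in> (f ^^ n) ` C' \<and> D = (f ^^ n) ` C \<and> D' = (f ^^ Suc n) ` C')"

definition tower_map :: "(real \<Rightarrow> real) \<Rightarrow> real \<times> real set \<Rightarrow> real \<times> real set" where
  "tower_map f = (\<lambda>(x, D). (f x, THE D'. edge_at f x D D'))"

text \<open>Density of the orbit refers to the disjoint union topology on the tower. The intervals
  in \<open>\<E>\<close> are required to cover the unit interval up to closure: they need not contain its
  endpoints, as the map \<open>x + x\<^bsup>1+\<alpha>\<^esup> (mod 1)\<close> does not take the value 1.\<close>

definition transitive_part :: "(real \<Rightarrow> real) \<Rightarrow> real set set \<Rightarrow> bool" where
  "transitive_part f \<E> \<longleftrightarrow>
     \<E> \<subseteq> domains f \<and>
     (\<forall>D\<in>\<E>. \<forall>D'. edge f D D' \<longrightarrow> D' \<in> \<E>) \<and>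
     (\<forall>D\<in>\<E>. \<forall>D'\<in>\<E>. (\<lambda>A B. A \<in> \<E> \<and> B \<in> \<E> \<and> edge f A B)\<^sup>+\<^sup>+ D D') \<and>
     (\<exists>p\<in>tower_over \<E>. \<forall>D\<in>\<E>. D \<subseteq> closure {x. \<exists>n. (tower_map f ^^ n) p = (x, D)}) \<and>
     closure (\<Union>\<E>) = I01"

section \<open>First-return inducing schemes\<close>

definition tower_partition :: "(real \<Rightarrow> real) \<Rightarrow> nat \<Rightarrow> (real \<times> real set) set set" where
  "tower_partition f N =
     join ((\<lambda>C. {p \<in> tower_over (domains f). fst p \<in> C}) ` cylinders f N)
          ((\<lambda>D. D \<times> {D}) ` domains f)"

definition returning ::
    "(real \<Rightarrow> real) \<Rightarrow> (real \<times> real set) set \<Rightarrow> (real \<times> real set) set" where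
  "returning f Y = {p \<in> Y. \<exists>n\<ge>1. (tower_map f ^^ n) p \<in> Y}"

definition return_time ::
    "(real \<Rightarrow> real) \<Rightarrow> (real \<times> real set) set \<Rightarrow> real \<times> real set \<Rightarrow> nat" where
  "return_time f Y p = (LEAST n. n \<ge> 1 \<and> (tower_map f ^^ n) p \<in> Y)"

text \<open>The interior below is taken in the real line: a set reaching an endpoint of its domain,
  even an endpoint of the unit interval, is not compactly contained.\<close>

definition first_return_scheme ::
    "(real \<Rightarrow> real) \<Rightarrow> real set \<Rightarrow> real set set \<Rightarrow> (real \<Rightarrow> nat) \<Rightarrow> bool" where
  "first_return_scheme f X \<X> \<tau> \<longleftrightarrow>
     inducing_scheme f X \<X> \<tau> \<and>
     (\<exists>\<E> D N Y. transitive_part f \<E> \<and> D \<in> \<E> \<and>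
        Y \<in> tower_partition f N \<and> Y \<subseteq> D \<times> {D} \<and> closure (fst ` Y) \<subseteq> interior D \<and>
        X = fst ` Y \<and>
        (\<forall>p\<in>returning f Y. \<tau> (fst p) = return_time f Y p) \<and>
        \<X> = branches (induced_map f \<tau>) (fst ` returning f Y))"

section \<open>The map and the potentials\<close>

definition manneville_pomeau :: "real \<Rightarrow> real \<Rightarrow> real" where
  "manneville_pomeau \<alpha> x = frac (x + x powr (1 + \<alpha>))"

definition holder_on :: "real set \<Rightarrow> (real \<Rightarrow> real) \<Rightarrow> bool" where
  "holder_on S \<phi> \<longleftrightarrow> (\<exists>\<theta> C. 0 < \<theta> \<and> \<theta> \<le> 1 \<and>
     (\<forall>x\<in>S. \<forall>y\<in>S. \<bar>\<phi> x - \<phi> y\<bar> \<le> C * \<bar>x - y\<bar> powr \<theta>))"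

end

theory Submission
  imports Defs "HOL-Real_Asymp.Real_Asymp"
begin

text \<open>
The potential is chosen so that the only equilibrium state is the point mass at the neutral
fixed point 0, and no first-return scheme sees this measure, because the base of such a scheme lies
in the open unit interval.

The point mass at 0 has free energy at least 0, so the pressure is nonnegative. It remains to
bound the free energy of an invariant measure by a negative multiple of the mass that it gives to
the right branch (\<open>free_energy_potential_le\<close>). An equilibrium state then gives no mass to the
right branch. Since every orbit that starts in the open interval enters this branch, the open
interval is null too, which contradicts compatibility.

Heuristically, code orbits by the two branches and cut the words into blocks, each a run of
left letters closed by a right letter. If the potential is \<open>b\<close> outside a small neighbourhood of
0, a block of length \<open>k\<close> has weight \<open>exp (k * b)\<close> as long as \<open>k\<close> is at most about \<open>N\<close>, and these
weights add up to less than \<open>exp b / (1 - exp b) < 1\<close>, since \<open>b < - ln 2\<close>. For longer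
blocks the germ \<open>- 2 * \<alpha> * x powr \<alpha>\<close> takes over: the orbit leaves 0 so slowly that the germ is at
most about \<open>- 2 / k\<close> when \<open>k\<close> steps remain (\<open>neg_powr_le_waiting_time\<close>), and the block weights
decay like \<open>exp (N * b) * (N / k)\<^sup>2\<close>. They are summable with a small sum. So the weights of
all blocks add up to less than 1, with room for an extra factor on each right letter. Such a
renewal structure bounds the sum of the weights of all words of length \<open>n\<close>; here the bound
\<open>n + 1\<close> is derived from a supersolution of the renewal equation (\<open>sum_word_weight_le\<close>,
\<open>renewal_bound_supersolution\<close>).

The passage from word weights to entropy is \<open>ks_entropy_le_of_word_weights\<close>. Since the entropy
is a supremum over all finite measurable partitions, the words have to be compared with arbitrary
partitions. This rests on Gibbs' inequality, on inner regularity of measures, and on the fact that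
a monotone branch is cut into few pieces by intervals.
\<close>

section \<open>Itineraries and refined partitions\<close>

primrec itinerary :: "('a \<Rightarrow> 'b) \<Rightarrow> ('a \<Rightarrow> 'a) \<Rightarrow> nat \<Rightarrow> 'a \<Rightarrow> 'b list" where
  "itinerary c T 0 x = []"
| "itinerary c T (Suc n) x = c x # itinerary c T n (T x)"

lemma length_itinerary [simp]: "length (itinerary c T n x) = n"
  by (induction n arbitrary: x) auto

lemma nth_itinerary: "i < n \<Longrightarrow> itinerary c T n x ! i = c ((T ^^ i) x)"
proof (induction n arbitrary: x i)
  case (Suc n)
  then show ?case by (cases i) (auto simp: funpow_swap1)
qed simp

lemma itinerary_eq_iff:
  "itinerary c T n x = itinerary c T n y \<longleftrightarrow> (\<forall>i<n. c ((T ^^ i) x) = c ((T ^^ i) y))"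
  by (simp add: list_eq_iff_nth_eq nth_itinerary)

lemma itinerary_Suc_eq_iff:
  "itinerary c T (Suc n) x = itinerary c T (Suc n) y \<longleftrightarrow>
     itinerary c T n x = itinerary c T n y \<and> c ((T ^^ n) x) = c ((T ^^ n) y)"
  unfolding itinerary_eq_iff by (auto simp: less_Suc_eq simp del: funpow.simps)

lemma funpow_mem: "T \<in> S \<rightarrow> S \<Longrightarrow> x \<in> S \<Longrightarrow> (T ^^ n) x \<in> S"
  by (induction n) auto

text \<open>Atoms of the refined partition correspond one to one to realised itineraries. This turns
subprobabilities on lists, which can be summed letter by letter, into subprobabilities on atoms.\<close>

lemma refinement_eq_itinerary_classes:
  assumes P: "partition_on S P" and T: "T \<in> S \<rightarrow> S" and ne: "S \<noteq> {}"
    and c: "\<And>x. x \<in> S \<Longrightarrow> c x \<in> P \<and> x \<in> c x"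
  shows "refinement S T P n = (\<lambda>x. {y \<in> S. itinerary c T n y = itinerary c T n x}) ` S"
proof (induction n)
  case 0
  show ?case using ne by auto
next
  case (Suc n)
  let ?cl = "\<lambda>n x. {y \<in> S. itinerary c T n y = itinerary c T n x}"
  let ?pre = "\<lambda>A. (T ^^ n) -` A \<inter> S"
  have uniq: "c y = A" if "y \<in> S" "y \<in> A" "A \<in> P" for y A
    using P c[of y] that unfolding partition_on_def disjoint_def by blast
  have split: "?cl (Suc n) z = ?cl n z \<inter> ?pre (c ((T ^^ n) z))" if "z \<in> S" for z
  proof -
    have "c ((T ^^ n) y) = c ((T ^^ n) z) \<longleftrightarrow> (T ^^ n) y \<in> c ((T ^^ n) z)" if "y \<in> S" for y
      using uniq[of "(T ^^ n) y" "c ((T ^^ n) z)"] c[of "(T ^^ n) y"] c[of "(T ^^ n) z"]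
        funpow_mem[OF T \<open>y \<in> S\<close>, of n] funpow_mem[OF T \<open>z \<in> S\<close>, of n] by auto
    then show ?thesis unfolding itinerary_Suc_eq_iff by blast
  qed
  show ?case
  proof (intro equalityI subsetI)
    fix Z assume "Z \<in> refinement S T P (Suc n)"
    then obtain x A where A: "A \<in> P" and x: "x \<in> S" and Z: "Z = ?cl n x \<inter> ?pre A" "Z \<noteq> {}"
      by (auto simp: join_def Suc)
    then obtain z where z: "z \<in> ?cl n x" "z \<in> ?pre A" by blast
    then have "c ((T ^^ n) z) = A" "z \<in> S"
      using uniq A funpow_mem[OF T] by auto
    then have "Z = ?cl (Suc n) z" using split[of z] z Z by auto
    then show "Z \<in> ?cl (Suc n) ` S" using \<open>z \<in> S\<close> by blast
  next
    fix Z assume "Z \<in> ?cl (Suc n) ` S"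
    then obtain z where z: "z \<in> S" "Z = ?cl (Suc n) z" by blast
    then have "Z \<noteq> {}" "c ((T ^^ n) z) \<in> P" using c funpow_mem[OF T] by auto
    then show "Z \<in> refinement S T P (Suc n)"
      using split[OF z(1)] z Suc unfolding refinement.simps join_def by blast
  qed
qed

lemma refinement_measurable:
  assumes T: "T \<in> measurable M M" and P: "P \<subseteq> sets M"
  shows "refinement (space M) T P n \<subseteq> sets M"
proof (induction n)
  case (Suc n)
  have "(T ^^ n) -` A \<inter> space M \<in> sets M" if "A \<in> P" for A
    using that P measurable_compose_n[OF T] by (auto intro: measurable_sets)
  then show ?case using Suc by (auto simp: join_def)
qed simp

lemma finite_refinement: "finite P \<Longrightarrow> finite (refinement S T P n)"
proof (induction n)
  case (Suc n)
  let ?Q = "(\<lambda>A. (T ^^ n) -` A \<inter> S) ` P"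
  have "join (refinement S T P n) ?Q \<subseteq> (\<lambda>(A, B). A \<inter> B) ` (refinement S T P n \<times> ?Q)"
    by (auto simp: join_def)
  then show ?case using Suc by (simp add: finite_subset)
qed simp

section \<open>Words\<close>

definition words :: "'a set \<Rightarrow> nat \<Rightarrow> 'a list set" where
  "words A n = {l. set l \<subseteq> A \<and> length l = n}"

lemma words_0 [simp]: "words A 0 = {[]}"
  by (auto simp: words_def)

lemma finite_words: "finite A \<Longrightarrow> finite (words A n)"
  by (simp add: words_def finite_lists_length_eq)

lemma itinerary_in_words:
  assumes "\<And>x. x \<in> S \<Longrightarrow> c x \<in> A" "T \<in> S \<rightarrow> S" "x \<in> S"
  shows "itinerary c T n x \<in> words A n"
  using assms(3)
proof (induction n arbitrary: x)
  case (Suc n)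
  then show ?case using assms(1,2) Suc.IH[of "T x"] by (auto simp: words_def)
qed simp

lemma sum_words_Suc:
  assumes "finite A"
  shows "(\<Sum>l\<in>words A (Suc n). F l) = (\<Sum>l\<in>words A n. \<Sum>a\<in>A. F (a # l))"
proof -
  have "words A (Suc n) = (\<lambda>(l, a). a # l) ` (words A n \<times> A)"
    by (auto simp: words_def length_Suc_conv image_iff)
  moreover have "inj_on (\<lambda>(l, a). a # l) (words A n \<times> A)"
    by (auto simp: inj_on_def)
  ultimately show ?thesis
    by (simp add: sum.reindex sum.cartesian_product case_prod_unfold)
qed

text \<open>A memoryless channel that corrupts the letters of a word \<open>m\<close> independently has total mass at
most one on the words it can output.\<close>

lemma sum_words_prod_le_1:
  fixes K :: "'a \<Rightarrow> 'b \<Rightarrow> real"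
  assumes A: "finite A" and K: "\<And>a b. 0 \<le> K a b" "\<And>b. (\<Sum>a\<in>A. K a b) \<le> 1"
  shows "(\<Sum>l\<in>words A n. \<Prod>i<n. K (l ! i) (m i)) \<le> 1"
proof (induction n arbitrary: m)
  case (Suc n)
  have "(\<Sum>l\<in>words A (Suc n). \<Prod>i<Suc n. K (l ! i) (m i))
      = (\<Sum>l\<in>words A n. (\<Sum>a\<in>A. K a (m 0)) * (\<Prod>i<n. K (l ! i) (m (Suc i))))"
    by (simp add: sum_words_Suc[OF A] prod.lessThan_Suc_shift sum_distrib_right del: prod.lessThan_Suc)
  also have "\<dots> \<le> (\<Sum>l\<in>words A n. \<Prod>i<n. K (l ! i) (m (Suc i)))"
    using K by (intro sum_mono mult_left_le_one_le prod_nonneg sum_nonneg) auto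
  also have "\<dots> \<le> 1" by (rule Suc)
  finally show ?case .
qed simp

section \<open>Gibbs' inequality\<close>

lemma gibbs_inequality:
  fixes p q :: "'a \<Rightarrow> real"
  assumes p: "\<And>a. a \<in> Q \<Longrightarrow> 0 \<le> p a" and q: "\<And>a. a \<in> Q \<Longrightarrow> 0 < q a"
    and sum: "sum p Q = 1" "sum q Q \<le> 1"
  shows "(\<Sum>a\<in>Q. - (p a * ln (p a))) \<le> (\<Sum>a\<in>Q. p a * - ln (q a))"
proof -
  have "- (p a * ln (p a)) \<le> p a * - ln (q a) + (q a - p a)" if "a \<in> Q" for a
  proof (cases "p a = 0")
    case False
    then have pos: "0 < p a" "0 < q a" using p[OF that] q[OF that] by auto
    have "p a * ln (q a / p a) \<le> p a * (q a / p a - 1)"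
      using pos by (intro mult_left_mono ln_le_minus_one) auto
    then show ?thesis using pos by (simp add: ln_div algebra_simps)
  qed (use q[OF that] in simp)
  then have "(\<Sum>a\<in>Q. - (p a * ln (p a))) \<le> (\<Sum>a\<in>Q. p a * - ln (q a) + (q a - p a))"
    by (rule sum_mono)
  also have "\<dots> \<le> (\<Sum>a\<in>Q. p a * - ln (q a))"
    using sum by (simp only: sum.distrib sum_subtractf)
  finally show ?thesis .
qed

text \<open>Gibbs' inequality in the form in which it is used: an entropy is bounded by the expected length
\<open>- ln q\<close> of any code. So upper bounds for entropy only require a good choice of \<open>q\<close>, with no
calculus of conditional entropies.\<close>

lemma partition_entropy_le_integral:
  assumes M: "prob_space M" and Q: "finite Q" "Q \<subseteq> sets M" "partition_on (space M) Q"
    and q: "\<And>A. A \<in> Q \<Longrightarrow> 0 < q A" "sum q Q \<le> 1"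
    and g: "integrable M g" "AE x in M. \<forall>A\<in>Q. x \<in> A \<longrightarrow> - ln (q A) \<le> g x"
  shows "partition_entropy M Q \<le> (\<integral>x. g x \<partial>M)"
proof -
  interpret prob_space M by fact
  have disj: "disjoint_family_on (\<lambda>A. A) Q"
    using Q(3) by (auto simp: partition_on_def disjoint_def disjoint_family_on_def)
  have "(\<Sum>A\<in>Q. measure M A) = measure M (\<Union>Q)"
    using finite_measure_finite_Union[OF Q(1) _ disj] Q(2) by simp
  then have one: "(\<Sum>A\<in>Q. measure M A) = 1"
    using Q(3) by (simp add: partition_on_def prob_space)
  have "partition_entropy M Q \<le> (\<Sum>A\<in>Q. measure M A * - ln (q A))"
    unfolding partition_entropy_def by (rule gibbs_inequality) (use q one in auto)
  also have "\<dots> = (\<Sum>A\<in>Q. \<integral>x. indicator A x * - ln (q A) \<partial>M)"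
    using Q(2) by (intro sum.cong refl) (auto simp: subset_iff)
  also have "\<dots> = (\<integral>x. (\<Sum>A\<in>Q. indicator A x * - ln (q A)) \<partial>M)"
    using Q(2) by (intro Bochner_Integration.integral_sum[symmetric])
      (auto intro!: integrable_mult_left simp: subset_iff less_top[symmetric])
  also have "\<dots> \<le> (\<integral>x. g x \<partial>M)"
  proof (rule integral_mono_AE)
    show "integrable M (\<lambda>x. \<Sum>A\<in>Q. indicator A x * - ln (q A))"
      using Q(2) by (intro Bochner_Integration.integrable_sum integrable_mult_left)
        (auto simp: subset_iff less_top[symmetric])
    show "AE x in M. (\<Sum>A\<in>Q. indicator A x * - ln (q A)) \<le> g x"
      using g(2) AE_space
    proof eventually_elim
      case (elim x)
      then obtain A where A: "A \<in> Q" "x \<in> A" using Q(3) by (auto simp: partition_on_def)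
      have "x \<notin> B" if "B \<in> Q - {A}" for B
        using that A Q(3) by (auto simp: partition_on_def disjoint_def)
      then have "(\<Sum>A\<in>Q. indicator A x * - ln (q A)) = - ln (q A)"
        using A Q(1) by (simp add: sum.remove[of Q A])
      then show ?case using elim A by auto
    qed
  qed (rule g)
  finally show ?thesis .
qed

lemma ks_entropy_nonneg:
  assumes "prob_space M" "T \<in> measurable M M"
  shows "0 \<le> ks_entropy M T"
proof -
  interpret prob_space M by fact
  let ?P = "{space M}"
  have "0 \<le> partition_entropy M Q" for Q
    unfolding partition_entropy_def
  proof (rule sum_nonneg)
    fix A
    have "ln (prob A) \<le> 0" by (cases "prob A = 0") (use prob_le_1[of A] in \<open>auto simp: zero_less_measure_iff\<close>)
    then show "0 \<le> - (prob A * ln (prob A))" by (simp add: mult_nonneg_nonpos)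
  qed
  then have "0 \<le> entropy_wrt_partition M T ?P"
    unfolding entropy_wrt_partition_def
    by (intro le_Limsup) auto
  also have "\<dots> \<le> ks_entropy M T"
    unfolding ks_entropy_def
    using not_empty by (intro SUP_upper) (simp add: partition_on_def)
  finally show ?thesis .
qed


section \<open>Bounding entropy by weights of words\<close>

lemma sets_restrict_borel_imp_borel:
  "A \<in> sets (restrict_space borel I01) \<Longrightarrow> A \<in> sets (borel :: real measure)"
  by (auto simp: sets_restrict_space)

text \<open>Inner regularity gives disjoint compact subsets of the partition elements that carry almost all
the mass. They have positive distance from each other, so a cell of a fine enough grid meets at
most one of them; hence off a small set \<open>E\<close> the monotone cell index \<open>r\<close> determines the partition
element.\<close>

lemma finite_partition_grid_approximation:
  fixes M :: "real measure"
  assumes M: "prob_space M" "sets M = sets (restrict_space borel I01)"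
    and P: "finite P" "P \<subseteq> sets M" "partition_on (space M) P" and e: "0 < e"
  obtains E and r :: "real \<Rightarrow> nat" and J d where
    "E \<in> sets M" "measure M E < e"
    "\<And>x y. x \<le> y \<Longrightarrow> r x \<le> r y" "\<And>x. x \<in> I01 \<Longrightarrow> r x \<le> J"
    "\<And>A x. A \<in> P \<Longrightarrow> x \<in> A - E \<Longrightarrow> d (r x) = A"
proof -
  interpret prob_space M by (rule M(1))
  have sp: "space M = I01" using sets_eq_imp_space_eq[OF M(2)] by (simp add: space_restrict_space)
  have id: "(\<lambda>x. x) \<in> measurable M borel"
    using M(2) by (subst measurable_cong_sets[OF M(2) refl]) (simp add: measurable_restrict_space1)
  define N where "N = distr M borel (\<lambda>x. x)"
  have N: "emeasure N A = emeasure M A" if "A \<in> sets borel" "A \<subseteq> I01" for A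
    using that id by (simp add: N_def emeasure_distr sp Int_absorb2)
  have "prob_space N" unfolding N_def by (rule prob_space_distr) (rule id)
  then have Nfin: "emeasure N (space N) \<noteq> \<infinity>" by (simp add: prob_space.emeasure_space_1)
  have borel: "A \<in> sets borel" "A \<subseteq> I01" if "A \<in> P" for A
    using that P(2,3) M(2) sets_restrict_borel_imp_borel[of A] sp by (auto simp: partition_on_def)
  define e' where "e' = e / (card P + 1)"
  have e': "0 < e'" using e by (simp add: e'_def)
  have "\<exists>K. K \<subseteq> A \<and> compact K \<and> measure M (A - K) < e'" if A: "A \<in> P" for A
  proof -
    have "\<exists>K\<in>{K. K \<subseteq> A \<and> compact K}. emeasure N A < emeasure N K + ennreal e'"
    proof (rule SUP_approx_ennreal)
      show "emeasure N A = (SUP K\<in>{K. K \<subseteq> A \<and> compact K}. emeasure N K)"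
        by (rule inner_regular) (use Nfin borel[OF A] in \<open>auto simp: N_def\<close>)
      show "emeasure N A \<noteq> \<infinity>" using N[OF borel[OF A]] by simp
    qed (use e' in auto)
    then obtain K where K: "K \<subseteq> A" "compact K" "emeasure N A < emeasure N K + ennreal e'" by blast
    have Kb: "K \<in> sets borel" using K(2) by (intro borel_closed compact_imp_closed)
    then have KM: "K \<in> sets M" using M(2) K(1) borel(2)[OF A]
      by (auto simp: sets_restrict_space_iff)
    have "emeasure M A < emeasure M K + ennreal e'"
      using K(3) N[OF borel[OF A]] N[OF Kb] K(1) borel(2)[OF A] by auto
    then have "measure M A < measure M K + e'"
      using e' by (simp add: emeasure_eq_measure ennreal_plus[symmetric] ennreal_less_iff del: ennreal_plus)
    then have "measure M (A - K) < e'"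
      using A P(2) KM K(1) by (subst finite_measure_Diff) auto
    then show ?thesis using K by blast
  qed
  then obtain K where K: "\<And>A. A \<in> P \<Longrightarrow> K A \<subseteq> A \<and> compact (K A) \<and> measure M (A - K A) < e'"
    by metis
  have disj: "A \<inter> B = {}" if "A \<in> P" "B \<in> P" "A \<noteq> B" for A B
    using that P(3) by (auto simp: partition_on_def disjoint_def)
  have "\<exists>\<delta>>0. \<forall>A\<in>P. \<forall>B\<in>P. A \<noteq> B \<longrightarrow> (\<forall>x\<in>K A. \<forall>y\<in>K B. \<delta> \<le> dist x y)"
  proof -
    have "\<exists>\<delta>>0. A \<noteq> B \<longrightarrow> (\<forall>x\<in>K A. \<forall>y\<in>K B. \<delta> \<le> dist x y)" if "A \<in> P" "B \<in> P" for A B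
    proof (cases "A = B")
      case False
      then show ?thesis
        using separate_compact_closed[of "K A" "K B"] K[OF that(1)] K[OF that(2)] disj[OF that]
          compact_imp_closed by blast
    qed (use zero_less_one in blast)
    then obtain \<delta> where \<delta>: "\<And>A B. A \<in> P \<Longrightarrow> B \<in> P \<Longrightarrow> 0 < \<delta> A B \<and>
        (A \<noteq> B \<longrightarrow> (\<forall>x\<in>K A. \<forall>y\<in>K B. \<delta> A B \<le> dist x y))"
      by metis
    let ?D = "insert 1 ((\<lambda>(A, B). \<delta> A B) ` (P \<times> P))"
    have fin: "finite ?D" using P(1) by simp
    show ?thesis
    proof (intro exI[of _ "Min ?D"] conjI ballI impI)
      show "0 < Min ?D" unfolding Min_gr_iff[OF fin insert_not_empty] using \<delta> by auto
      fix A B x y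
      assume *: "A \<in> P" "B \<in> P" "A \<noteq> B" "x \<in> K A" "y \<in> K B"
      have "\<delta> A B \<in> ?D"
        by (rule insertI2, rule image_eqI[of _ _ "(A, B)"]) (simp_all add: *)
      then have "Min ?D \<le> \<delta> A B" by (rule Min_le[OF fin])
      also have "\<dots> \<le> dist x y" using \<delta>[OF *(1,2)] *(3-5) by blast
      finally show "Min ?D \<le> dist x y" .
    qed
  qed
  then obtain \<delta> where \<delta>: "0 < \<delta>"
    "\<forall>A\<in>P. \<forall>B\<in>P. A \<noteq> B \<longrightarrow> (\<forall>x\<in>K A. \<forall>y\<in>K B. \<delta> \<le> dist x y)"
    by (elim exE conjE)
  obtain m where m: "inverse (real (Suc m)) < \<delta>" using reals_Archimedean[OF \<delta>(1)] by blast
  define r where "r = (\<lambda>x. nat \<lfloor>real (Suc m) * x\<rfloor>)"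
  have close: "dist x y < \<delta>" if "r x = r y" "x \<in> I01" "y \<in> I01" for x y
  proof -
    have "\<lfloor>real (Suc m) * x\<rfloor> = \<lfloor>real (Suc m) * y\<rfloor>"
      using that by (simp add: r_def eq_nat_nat_iff)
    then have "\<bar>real (Suc m) * x - real (Suc m) * y\<bar> < 1" by linarith
    then have "real (Suc m) * \<bar>x - y\<bar> < 1"
      by (simp add: abs_mult right_diff_distrib[symmetric] del: of_nat_Suc)
    then have "\<bar>x - y\<bar> < inverse (real (Suc m))" by (simp add: field_simps del: of_nat_Suc)
    then show ?thesis using m by (simp add: dist_real_def)
  qed
  define d where "d = (\<lambda>j. SOME A. A \<in> P \<and> (\<exists>x\<in>K A. r x = j))"
  define E where "E = space M - (\<Union>A\<in>P. K A)"
  have KM: "K A \<in> sets M" if "A \<in> P" for A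
    using K[OF that] M(2) borel(2)[OF that] compact_imp_closed[of "K A"]
    by (auto simp: sets_restrict_space_iff intro!: borel_closed)
  have "E \<in> sets M" using KM P(1) unfolding E_def by auto
  moreover have "measure M E < e"
  proof -
    have "space M = \<Union>P" using P(3) by (simp add: partition_on_def)
    then have "E \<subseteq> (\<Union>A\<in>P. A - K A)" by (auto simp: E_def)
    then have "measure M E \<le> measure M (\<Union>A\<in>P. A - K A)"
      using KM P(1,2) by (intro finite_measure_mono sets.finite_UN) auto
    also have "\<dots> \<le> (\<Sum>A\<in>P. measure M (A - K A))"
      using KM P(1,2) by (intro finite_measure_subadditive_finite) auto
    also have "\<dots> \<le> (\<Sum>A\<in>P. e')" by (intro sum_mono) (use K in \<open>auto intro: less_imp_le\<close>)
    also have "\<dots> < e" using e by (simp add: e'_def field_simps)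
    finally show ?thesis .
  qed
  moreover have "r x \<le> r y" if "x \<le> y" for x y
    using that unfolding r_def by (intro nat_mono floor_mono mult_left_mono) auto
  moreover have "r x \<le> Suc m" if "x \<in> I01" for x
  proof -
    have "r x \<le> nat \<lfloor>real (Suc m) * 1\<rfloor>"
      unfolding r_def using that by (intro nat_mono floor_mono mult_left_mono) auto
    also have "\<dots> = Suc m" by (simp only: mult_1_right floor_of_nat nat_int)
    finally show ?thesis .
  qed
  moreover have "d (r x) = A" if A: "A \<in> P" and x: "x \<in> A - E" for A x
  proof -
    obtain A' where A': "A' \<in> P" "x \<in> K A'"
      using A x P(3) by (auto simp: E_def partition_on_def)
    then have "x \<in> A \<inter> A'" using K[OF A'(1)] x by blast
    then have "A' = A" using disj[OF that(1) A'(1)] by blast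
    then have "x \<in> K A" using A'(2) by simp
    then have ex: "A \<in> P \<and> (\<exists>y\<in>K A. r y = r x)" using that by blast
    have "d (r x) \<in> P \<and> (\<exists>y\<in>K (d (r x)). r y = r x)"
      unfolding d_def by (rule someI[of _ A]) (rule ex)
    then obtain y where y: "d (r x) \<in> P" "y \<in> K (d (r x))" "r y = r x" by blast
    have "dist y x < \<delta>"
      using K[OF y(1)] K[OF that(1)] borel(2)[OF y(1)] borel(2)[OF that(1)] y(2) \<open>x \<in> K A\<close>
      by (intro close y(3)) blast+
    then show ?thesis
      using \<delta>(2)[rule_format, OF y(1) that(1) _ y(2) \<open>x \<in> K A\<close>] by linarith
  qed
  ultimately show ?thesis by (rule that)
qed

text \<open>On a cylinder of \<open>\<sigma>\<close> the iterates are monotone, so each \<open>r ((T ^^ i) x)\<close> is nondecreasing in \<open>x\<close>,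
and two points with the same sum must agree in every summand. Thus the \<open>r\<close>-itineraries of length
\<open>n\<close> in one cylinder number at most \<open>n * J + 1\<close>, if \<open>J\<close> bounds \<open>r\<close>: intervals cut a
monotone branch into few pieces, and no expansion is needed for the cylinders of \<open>\<sigma>\<close> to carry all
the entropy.\<close>

lemma monotone_counter_determines_itinerary:
  fixes T :: "'a::linorder \<Rightarrow> 'a" and r :: "'a \<Rightarrow> nat"
  assumes T: "T \<in> B \<rightarrow> B"
    and mono: "\<And>x y. x \<in> B \<Longrightarrow> y \<in> B \<Longrightarrow> x \<le> y \<Longrightarrow> \<sigma> x = \<sigma> y \<Longrightarrow> T x \<le> T y"
    and r: "\<And>x y. x \<le> y \<Longrightarrow> r x \<le> r y"
    and x: "x \<in> B" and y: "y \<in> B" and word: "itinerary \<sigma> T n x = itinerary \<sigma> T n y"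
    and count: "(\<Sum>i<n. r ((T ^^ i) x)) = (\<Sum>i<n. r ((T ^^ i) y))"
  shows "itinerary r T n x = itinerary r T n y"
proof -
  have *: "r ((T ^^ i) x) = r ((T ^^ i) y)"
    if "x \<le> y" "x \<in> B" "y \<in> B" "itinerary \<sigma> T n x = itinerary \<sigma> T n y"
      "(\<Sum>i<n. r ((T ^^ i) x)) = (\<Sum>i<n. r ((T ^^ i) y))" "i < n" for x y i
  proof -
    have le: "(T ^^ j) x \<le> (T ^^ j) y" if "j \<le> n" for j
      using \<open>j \<le> n\<close>
    proof (induction j)
      case (Suc j)
      then show ?case
        using \<open>itinerary \<sigma> T n x = itinerary \<sigma> T n y\<close> funpow_mem[OF T, of _ j] \<open>y \<in> B\<close> \<open>x \<in> B\<close>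
        by (auto simp: itinerary_eq_iff intro!: mono)
    qed (use \<open>x \<le> y\<close> in simp)
    show ?thesis
    proof (rule sum_mono_inv[where I = "{..<n}" and f = "\<lambda>i. r ((T ^^ i) x)"
          and g = "\<lambda>i. r ((T ^^ i) y)"])
      show "(\<Sum>i<n. r ((T ^^ i) x)) = (\<Sum>i<n. r ((T ^^ i) y))" by (rule that(5))
      show "r ((T ^^ j) x) \<le> r ((T ^^ j) y)" if "j \<in> {..<n}" for j
        using that by (intro r le) simp
    qed (use \<open>i < n\<close> in auto)
  qed
  show ?thesis
  proof (cases "x \<le> y")
    case True
    then show ?thesis using *[OF _ x y word count] by (simp add: itinerary_eq_iff)
  next
    case False
    then show ?thesis using *[OF _ y x word[symmetric] count[symmetric]] by (simp add: itinerary_eq_iff)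
  qed
qed

lemma integral_birkhoff_sum:
  fixes g :: "'a \<Rightarrow> real"
  assumes T: "T \<in> measurable M M" "distr M M T = M" and g: "integrable M g"
  shows "integrable M (\<lambda>x. \<Sum>i<n. g ((T ^^ i) x))"
    and "(\<integral>x. (\<Sum>i<n. g ((T ^^ i) x)) \<partial>M) = n * (\<integral>x. g x \<partial>M)"
proof -
  have *: "integrable M (\<lambda>x. g ((T ^^ i) x)) \<and> (\<integral>x. g ((T ^^ i) x) \<partial>M) = (\<integral>x. g x \<partial>M)" for i
  proof (induction i)
    case (Suc i)
    let ?h = "\<lambda>x. g ((T ^^ i) x)"
    have "integrable (distr M M T) ?h" using Suc T(2) by simp
    then have "integrable M (\<lambda>x. ?h (T x))" by (rule integrable_distr[OF T(1)])
    moreover have "(\<integral>x. ?h x \<partial>distr M M T) = (\<integral>x. ?h (T x) \<partial>M)"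
      by (rule integral_distr[OF T(1)]) (use Suc in auto)
    ultimately show ?case using Suc T(2) by (simp add: funpow_swap1)
  qed (use g in simp)
  then show "integrable M (\<lambda>x. \<Sum>i<n. g ((T ^^ i) x))" by auto
  show "(\<integral>x. (\<Sum>i<n. g ((T ^^ i) x)) \<partial>M) = n * (\<integral>x. g x \<partial>M)"
    using * by (subst Bochner_Integration.integral_sum) auto
qed


text \<open>A one-sided variational principle for piecewise monotone maps. If the weights \<open>G\<close> of the words of
length \<open>n\<close> have total at most \<open>n + 1\<close> and dominate \<open>exp\<close> of the Birkhoff sums of \<open>\<psi>\<close>, then
\<open>G\<close> is, up to a polynomial factor, a subprobability, and coding a point by its word costs at most
\<open>- \<integral>\<psi>\<close> per step. To code an arbitrary finite partition \<open>P\<close>, three ingredients are multiplied: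
the weight of the word, the uniform weight of the counter that fixes the grid itinerary
inside the cylinder, and a channel of small noise \<open>\<eta>\<close> that corrects the rare errors of the grid
approximation to \<open>P\<close>. The counter contributes \<open>ln (n * J + 1)\<close>, which is negligible, and the
channel at most \<open>\<zeta>\<close> per step.\<close>

theorem ks_entropy_le_of_word_weights:
  fixes M :: "real measure" and T :: "real \<Rightarrow> real" and \<psi> :: "real \<Rightarrow> real"
    and \<sigma> :: "real \<Rightarrow> 'b" and G :: "'b list \<Rightarrow> real"
  assumes M: "prob_space M" "sets M = sets (restrict_space borel I01)"
    and T: "T \<in> measurable M M" "distr M M T = M"
    and B: "AE x in M. x \<in> B" "T \<in> B \<rightarrow> B" "B \<subseteq> I01"
    and mono: "\<And>x y. x \<in> B \<Longrightarrow> y \<in> B \<Longrightarrow> x \<le> y \<Longrightarrow> \<sigma> x = \<sigma> y \<Longrightarrow> T x \<le> T y"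
    and \<sigma>: "finite L" "\<And>x. x \<in> B \<Longrightarrow> \<sigma> x \<in> L"
    and \<psi>: "integrable M \<psi>"
    and G: "\<And>w. 0 < G w" "\<And>n. (\<Sum>w\<in>words L n. G w) \<le> real n + 1"
    and orbit: "\<And>n x. x \<in> B \<Longrightarrow> exp (\<Sum>i<n. \<psi> ((T ^^ i) x)) \<le> G (itinerary \<sigma> T n x)"
  shows "ks_entropy M T \<le> ereal (- (\<integral>x. \<psi> x \<partial>M))"
  unfolding ks_entropy_def
proof (rule SUP_least)
  fix P assume "P \<in> {P. finite P \<and> P \<subseteq> sets M \<and> partition_on (space M) P}"
  then have P: "finite P" "P \<subseteq> sets M" "partition_on (space M) P" by auto
  interpret prob_space M by (rule M(1))
  have sp: "space M = I01" using sets_eq_imp_space_eq[OF M(2)] by (simp add: space_restrict_space)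
  have TS: "T \<in> space M \<rightarrow> space M" using measurable_space[OF T(1)] by auto
  have "\<forall>x. \<exists>A. x \<in> space M \<longrightarrow> A \<in> P \<and> x \<in> A" using P(3) by (auto simp: partition_on_def)
  then obtain c where c: "\<And>x. x \<in> space M \<Longrightarrow> c x \<in> P \<and> x \<in> c x" by metis
  have B_ne: "B \<noteq> {}" using B(1) not_empty by (auto simp: AE_False)
  have P_ne: "P \<noteq> {}" using c not_empty by auto
  show "entropy_wrt_partition M T P \<le> ereal (- (\<integral>x. \<psi> x \<partial>M))"
  proof (rule ereal_le_epsilon2)
    fix \<zeta> :: real assume \<zeta>: "0 < \<zeta>"
    define k where "k = real (card P)"
    have k: "1 \<le> k" using P(1) P_ne by (simp add: k_def Suc_leI card_gt_0_iff)
    \<comment> \<open>Chosen so that an uncorrupted letter costs \<open>- ln (1 - \<eta>) = \<zeta> / 2\<close>; a corrupted one costs \<open>\<Lambda>\<close>.\<close>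
    define \<eta> where "\<eta> = 1 - exp (- (\<zeta> / 2))"
    have \<eta>: "0 < \<eta>" "\<eta> < 1" using \<zeta> by (auto simp: \<eta>_def)
    define \<Lambda> where "\<Lambda> = ln (k / \<eta>)"
    have "1 \<le> k / \<eta>" using k \<eta> by (simp add: field_simps)
    then have \<Lambda>: "0 \<le> \<Lambda>" by (simp add: \<Lambda>_def)
    define K :: "real set \<Rightarrow> real set \<Rightarrow> real" where "K = (\<lambda>a b. if a = b then 1 - \<eta> else \<eta> / k)"
    have K_pos: "0 < K a b" for a b using \<eta> k by (auto simp: K_def)
    have K_sum: "(\<Sum>a\<in>P. K a b) \<le> 1" for b
    proof -
      have "(\<Sum>a\<in>P. K a b) \<le> (\<Sum>a\<in>P. (if a = b then 1 - \<eta> else 0) + \<eta> / k)"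
        using \<eta> k by (intro sum_mono) (auto simp: K_def)
      also have "\<dots> = (\<Sum>a\<in>P. if a = b then 1 - \<eta> else 0) + \<eta>"
        using k by (simp add: sum.distrib k_def)
      also have "\<dots> \<le> 1" using \<eta> P(1) by (simp add: sum.delta)
      finally show ?thesis .
    qed
    \<comment> \<open>Corrupted letters occur on \<open>E\<close> only, so a set of measure below \<open>e\<close> adds at most \<open>\<zeta> / 2\<close>.\<close>
    define e where "e = \<zeta> / 2 / (\<Lambda> + 1)"
    have e: "0 < e" using \<zeta> \<Lambda> by (simp add: e_def)
    obtain E and r :: "real \<Rightarrow> nat" and J d where E: "E \<in> sets M" "measure M E < e"
      and r: "\<And>x y. x \<le> y \<Longrightarrow> r x \<le> r y" "\<And>x. x \<in> I01 \<Longrightarrow> r x \<le> J"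
      and d: "\<And>A x. A \<in> P \<Longrightarrow> x \<in> A - E \<Longrightarrow> d (r x) = A"
      using finite_partition_grid_approximation[OF M P e] by blast
    \<comment> \<open>Bounds the code length per step, up to an error of size \<open>ln n\<close> in total.\<close>
    define \<theta> where "\<theta> = (\<lambda>x. - \<psi> x + \<zeta> / 2 + \<Lambda> * indicator E x)"
    have \<theta>_int: "integrable M \<theta>"
      unfolding \<theta>_def using \<psi> E(1)
      by (intro Bochner_Integration.integrable_add integrable_mult_right integrable_minus)
        (auto simp: less_top[symmetric])
    have "(\<integral>x. \<theta> x \<partial>M) = - (\<integral>x. \<psi> x \<partial>M) + \<zeta> / 2 + \<Lambda> * measure M E"
      unfolding \<theta>_def using \<psi> E(1)
      by (subst Bochner_Integration.integral_add | simp add: less_top[symmetric] prob_space)+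
    moreover have "\<Lambda> * measure M E \<le> \<zeta> / 2"
    proof -
      have "\<Lambda> * measure M E \<le> (\<Lambda> + 1) * e"
        using \<Lambda> E(2) e by (intro mult_mono) auto
      also have "\<dots> = \<zeta> / 2" using \<Lambda> by (simp add: e_def field_simps)
      finally show ?thesis .
    qed
    ultimately have \<theta>_le: "(\<integral>x. \<theta> x \<partial>M) \<le> - (\<integral>x. \<psi> x \<partial>M) + \<zeta>" by simp
    have noise: "- ln (K (c x) (d (r x))) \<le> \<zeta> / 2 + \<Lambda> * indicator E x" if "x \<in> space M" for x
    proof (cases "d (r x) = c x")
      case True
      then show ?thesis using \<Lambda> by (simp add: K_def \<eta>_def)
    next
      case False
      then have "x \<in> E" using c[OF that] d[of "c x" x] by auto
      then show ?thesis using False \<eta> k \<zeta> by (simp add: K_def \<Lambda>_def ln_div)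
    qed
    have bound: "partition_entropy M (refinement (space M) T P n)
        \<le> real n * (- (\<integral>x. \<psi> x \<partial>M) + \<zeta>) + ln ((real n + 1) * (real n * real J + 1))" for n
    proof -
      define C where "C = (real n + 1) * (real n * real J + 1)"
      have C: "0 < C" by (simp add: C_def add_nonneg_pos)
      define codes where "codes = words L n \<times> {..n * J}"
      have codes: "finite codes" using \<sigma>(1) by (simp add: codes_def finite_words)
      define code where "code = (\<lambda>x. (itinerary \<sigma> T n x, \<Sum>i<n. r ((T ^^ i) x)))"
      have code_mem: "code x \<in> codes" if "x \<in> B" for x
      proof -
        have "(\<Sum>i<n. r ((T ^^ i) x)) \<le> (\<Sum>i<n. J)"
          by (intro sum_mono r(2) subsetD[OF B(3)] funpow_mem[OF B(2) that])
        then show ?thesis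
          using itinerary_in_words[OF \<sigma>(2) B(2) that] by (simp add: code_def codes_def)
      qed
      define decode where "decode = (\<lambda>u. itinerary r T n (SOME x. x \<in> B \<and> code x = u))"
      have decode: "decode (code x) = itinerary r T n x" if "x \<in> B" for x
      proof -
        let ?y = "SOME y. y \<in> B \<and> code y = code x"
        have "?y \<in> B \<and> code ?y = code x" by (rule someI[of _ x]) (use that in simp)
        then show ?thesis
          unfolding decode_def using that
          by (intro monotone_counter_determines_itinerary[OF B(2) mono r(1)]) (auto simp: code_def)
      qed
      \<comment> \<open>The mass of \<open>l\<close> as the output of the noisy channel whose input is a decoded random code.\<close>
      define q where "q = (\<lambda>l. \<Sum>u\<in>codes. G (fst u) / C * (\<Prod>i<n. K (l ! i) (d (decode u ! i))))"
      have term_pos: "0 < G (fst u) / C * (\<Prod>i<n. K (l ! i) (d (decode u ! i)))" for u l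
        using G(1) C K_pos by (intro mult_pos_pos divide_pos_pos prod_pos) auto
      have q_pos: "0 < q l" for l
        unfolding q_def using codes code_mem B_ne term_pos by (intro sum_pos) auto
      have q_sum: "(\<Sum>l\<in>words P n. q l) \<le> 1"
      proof -
        have "(\<Sum>l\<in>words P n. q l)
            = (\<Sum>u\<in>codes. G (fst u) / C * (\<Sum>l\<in>words P n. \<Prod>i<n. K (l ! i) (d (decode u ! i))))"
          unfolding q_def by (subst sum.swap) (simp add: sum_distrib_left)
        also have "\<dots> \<le> (\<Sum>u\<in>codes. G (fst u) / C)"
          using G(1) C K_pos K_sum P(1)
          by (intro sum_mono mult_left_le sum_words_prod_le_1) (auto intro: less_imp_le)
        also have "\<dots> = (\<Sum>w\<in>words L n. \<Sum>j\<le>n * J. G w / C)"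
          unfolding codes_def by (simp only: sum.cartesian_product case_prod_unfold fst_conv)
        also have "\<dots> = (\<Sum>w\<in>words L n. (real n * real J + 1) * (G w / C))" by (simp add: add.commute)
        also have "\<dots> = (\<Sum>w\<in>words L n. G w) * (real n * real J + 1) / C"
          by (simp add: sum_distrib_left[symmetric] sum_distrib_right[symmetric] sum_divide_distrib[symmetric] mult.commute)
        also have "\<dots> \<le> (real n + 1) * (real n * real J + 1) / C"
          using C G(2) by (intro divide_right_mono mult_right_mono) auto
        also have "\<dots> = 1" unfolding C_def[symmetric] using C by simp
        finally show ?thesis .
      qed
      have q_orbit: "- ln (q (itinerary c T n x)) \<le> (\<Sum>i<n. \<theta> ((T ^^ i) x)) + ln C" if x: "x \<in> B" for x
      proof -
        have xS: "(T ^^ i) x \<in> space M" for i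
          unfolding sp by (intro subsetD[OF B(3)] funpow_mem[OF B(2) x])
        have "G (itinerary \<sigma> T n x) / C * (\<Prod>i<n. K (c ((T ^^ i) x)) (d (r ((T ^^ i) x))))
            = G (fst (code x)) / C * (\<Prod>i<n. K (itinerary c T n x ! i) (d (decode (code x) ! i)))"
          unfolding decode[OF x] by (simp add: nth_itinerary code_def)
        also have "\<dots> \<le> q (itinerary c T n x)"
          unfolding q_def using code_mem[OF x] codes term_pos
          by (intro member_le_sum[of "code x" codes]) (auto intro: less_imp_le)
        finally have code_le: "G (itinerary \<sigma> T n x) / C * (\<Prod>i<n. K (c ((T ^^ i) x)) (d (r ((T ^^ i) x))))
            \<le> q (itinerary c T n x)" .
        have prod_pos: "0 < (\<Prod>i<n. K (c ((T ^^ i) x)) (d (r ((T ^^ i) x))))"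
          using K_pos by (intro prod_pos) auto
        have "exp (\<Sum>i<n. \<psi> ((T ^^ i) x)) / C * (\<Prod>i<n. K (c ((T ^^ i) x)) (d (r ((T ^^ i) x))))
            \<le> q (itinerary c T n x)"
          by (rule order_trans[OF mult_right_mono[OF divide_right_mono[OF orbit[OF x]]] code_le])
            (use C prod_pos in auto)
        then have "ln (exp (\<Sum>i<n. \<psi> ((T ^^ i) x)) / C
              * (\<Prod>i<n. K (c ((T ^^ i) x)) (d (r ((T ^^ i) x)))))
            \<le> ln (q (itinerary c T n x))"
          using C prod_pos q_pos by (subst ln_le_cancel_iff) auto
        moreover have "ln (exp (\<Sum>i<n. \<psi> ((T ^^ i) x)) / C
              * (\<Prod>i<n. K (c ((T ^^ i) x)) (d (r ((T ^^ i) x)))))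
            = (\<Sum>i<n. \<psi> ((T ^^ i) x)) - ln C + (\<Sum>i<n. ln (K (c ((T ^^ i) x)) (d (r ((T ^^ i) x)))))"
          using C K_pos prod_pos by (simp add: ln_mult ln_div ln_prod less_imp_neq[symmetric])
        moreover have "(\<Sum>i<n. - ln (K (c ((T ^^ i) x)) (d (r ((T ^^ i) x)))))
            \<le> (\<Sum>i<n. \<zeta> / 2 + \<Lambda> * indicator E ((T ^^ i) x))"
          by (intro sum_mono noise xS)
        moreover have "(\<Sum>i<n. \<theta> ((T ^^ i) x))
            = - (\<Sum>i<n. \<psi> ((T ^^ i) x)) + (\<Sum>i<n. \<zeta> / 2 + \<Lambda> * indicator E ((T ^^ i) x))"
          unfolding \<theta>_def by (simp add: sum.distrib sum_subtractf)
        ultimately show ?thesis by (simp add: sum_negf)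
      qed
      let ?Q = "refinement (space M) T P n"
      have Q_eq: "?Q = (\<lambda>x. {y \<in> space M. itinerary c T n y = itinerary c T n x}) ` space M"
        by (rule refinement_eq_itinerary_classes[OF P(3) TS not_empty c])
      define pt where "pt = (\<lambda>A :: real set. SOME x. x \<in> A)"
      have pt: "pt A \<in> A" "A = {y \<in> space M. itinerary c T n y = itinerary c T n (pt A)}"
        if A: "A \<in> ?Q" for A
      proof -
        obtain x where x: "x \<in> space M" "A = {y \<in> space M. itinerary c T n y = itinerary c T n x}"
          using A Q_eq by auto
        then have "x \<in> A" by simp
        then show "pt A \<in> A" unfolding pt_def by (rule someI)
        then show "A = {y \<in> space M. itinerary c T n y = itinerary c T n (pt A)}"
          using x by auto
      qed
      define q' where "q' = (\<lambda>A. q (itinerary c T n (pt A)))"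
      have "partition_entropy M ?Q \<le> (\<integral>x. (\<Sum>i<n. \<theta> ((T ^^ i) x)) + ln C \<partial>M)"
      proof (rule partition_entropy_le_integral[OF M(1) finite_refinement[OF P(1)]
            refinement_measurable[OF T(1) P(2)]])
        show "partition_on (space M) ?Q"
          unfolding Q_eq by (auto simp: partition_on_def disjoint_def)
        show "0 < q' A" for A by (simp add: q'_def q_pos)
        have "inj_on (\<lambda>A. itinerary c T n (pt A)) ?Q"
          by (rule inj_onI) (metis pt(2))
        then have "sum q' ?Q = sum q ((\<lambda>A. itinerary c T n (pt A)) ` ?Q)"
          by (simp add: sum.reindex q'_def)
        also have "\<dots> \<le> sum q (words P n)"
        proof (rule sum_mono2)
          have "pt A \<in> space M" if "A \<in> ?Q" for A using pt[OF that] by blast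
          then show "(\<lambda>A. itinerary c T n (pt A)) ` ?Q \<subseteq> words P n"
            using c by (auto intro!: itinerary_in_words[OF _ TS])
        qed (use P(1) q_pos in \<open>auto intro: finite_words less_imp_le\<close>)
        finally show "sum q' ?Q \<le> 1" using q_sum by simp
        show "integrable M (\<lambda>x. (\<Sum>i<n. \<theta> ((T ^^ i) x)) + ln C)"
          using integral_birkhoff_sum(1)[OF T \<theta>_int] by auto
        show "AE x in M. \<forall>A\<in>?Q. x \<in> A \<longrightarrow> - ln (q' A) \<le> (\<Sum>i<n. \<theta> ((T ^^ i) x)) + ln C"
          using B(1)
        proof eventually_elim
          case (elim x)
          show ?case
          proof (intro ballI impI)
            fix A assume A: "A \<in> ?Q" "x \<in> A"
            then have "itinerary c T n x = itinerary c T n (pt A)" using pt(2)[OF A(1)] by blast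
            then show "- ln (q' A) \<le> (\<Sum>i<n. \<theta> ((T ^^ i) x)) + ln C"
              using q_orbit[OF elim] by (simp add: q'_def)
          qed
        qed
      qed
      also have "\<dots> = n * (\<integral>x. \<theta> x \<partial>M) + ln C"
        using integral_birkhoff_sum[OF T \<theta>_int, of n] by (simp add: prob_space)
      also have "\<dots> \<le> n * (- (\<integral>x. \<psi> x \<partial>M) + \<zeta>) + ln C"
        using \<theta>_le by (intro add_right_mono mult_left_mono) auto
      finally show ?thesis by (simp add: C_def)
    qed
    define \<rho> where "\<rho> = (\<lambda>n. - (\<integral>x. \<psi> x \<partial>M) + \<zeta> + ln ((real n + 1) * (real n * real J + 1)) / real n)"
    have "\<rho> \<longlonglongrightarrow> - (\<integral>x. \<psi> x \<partial>M) + \<zeta>"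
    proof -
      have "(\<lambda>n. ln (real n + 1) / real n + ln (real n * real J + 1) / real n) \<longlonglongrightarrow> 0"
      proof (cases "J = 0")
        case False
        then have "0 < real J" by simp
        then show ?thesis by real_asymp
      next
        case True
        then show ?thesis by simp real_asymp
      qed
      moreover have "ln ((real n + 1) * (real n * real J + 1)) / real n
          = ln (real n + 1) / real n + ln (real n * real J + 1) / real n" for n
        by (simp add: ln_mult add_nonneg_pos add_divide_distrib add_nonneg_eq_0_iff)
      ultimately have "(\<lambda>n. ln ((real n + 1) * (real n * real J + 1)) / real n) \<longlonglongrightarrow> 0"
        by simp
      from tendsto_add[OF tendsto_const this] show ?thesis by (simp add: \<rho>_def)
    qed
    then have "limsup (\<lambda>n. ereal (\<rho> n)) = ereal (- (\<integral>x. \<psi> x \<partial>M) + \<zeta>)"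
      by (intro lim_imp_Limsup) auto
    moreover have "entropy_wrt_partition M T P \<le> limsup (\<lambda>n. ereal (\<rho> n))"
      unfolding entropy_wrt_partition_def
    proof (rule Limsup_mono, rule eventually_mono[OF eventually_gt_at_top[of 0]])
      fix n :: nat assume n: "0 < n"
      then show "ereal (partition_entropy M (refinement (space M) T P n) / real n) \<le> ereal (\<rho> n)"
        using bound[of n] by (simp add: \<rho>_def field_simps)
    qed
    ultimately show "entropy_wrt_partition M T P \<le> ereal (- (\<integral>x. \<psi> x \<partial>M)) + ereal \<zeta>" by simp
  qed
qed


section \<open>Weights of binary words\<close>

text \<open>The letter \<open>True\<close> stands for the right branch. The cost of staying on the left depends on how long
the orbit is going to stay there, hence on the number of letters \<open>False\<close> that follow; this is why
words are weighted from the end to the beginning. A final run of \<open>False\<close>, whose waiting time the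
word does not reveal, gets the trivial weight 1.\<close>

primrec word_weight :: "(nat \<Rightarrow> real) \<Rightarrow> real \<Rightarrow> bool list \<Rightarrow> real" where
  "word_weight W a [] = 1"
| "word_weight W a (y # w) = word_weight W a w *
     (if y then a else if True \<in> set w then W (Suc (length (takeWhile Not w))) else 1)"

lemma word_weight_pos: "(\<And>k. 0 < W k) \<Longrightarrow> 0 < a \<Longrightarrow> 0 < word_weight W a w"
  by (induction w) auto

lemma word_weight_no_True: "True \<notin> set w \<Longrightarrow> word_weight W a w = 1"
  by (induction w) auto

text \<open>Let the sum over words be weighted by \<open>U\<close> of the number of leading letters \<open>False\<close>. By the
hypothesis on \<open>U\<close>, prepending a letter in both ways does not increase the contribution of a word
that contains \<open>True\<close>: the letter \<open>True\<close> contributes \<open>1 / U 0 * U 0 = 1\<close>, the letter \<open>False\<close> the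
product of \<open>W\<close> and \<open>U\<close>. The word without \<open>True\<close>, of contribution 1, produces a 1 twice, so the sum grows
by at most 1 with each step.\<close>

lemma sum_word_weight_le:
  assumes W: "\<And>k. 0 < W k" and U: "\<And>k. 1 \<le> U k" "\<And>k. 1 + W (Suc k) * U (Suc k) \<le> U k"
  shows "(\<Sum>w\<in>words UNIV n. word_weight W (1 / U 0) w) \<le> real n + 1"
proof -
  define h where "h = (\<lambda>w. if True \<in> set w then U (length (takeWhile Not w)) else 1)"
  let ?g = "word_weight W (1 / U 0)"
  have U0: "0 < U 0" using U(1)[of 0] by linarith
  have g: "0 < ?g w" for w using W U0 by (intro word_weight_pos) auto
  have step: "(\<Sum>y\<in>UNIV. ?g (y # w) * h (y # w)) \<le> ?g w * h w + (if True \<in> set w then 0 else 1)" for w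
  proof (cases "True \<in> set w")
    case True
    then have "(\<Sum>y\<in>UNIV. ?g (y # w) * h (y # w))
        = ?g w * (1 + W (Suc (length (takeWhile Not w))) * U (Suc (length (takeWhile Not w))))"
      using U0 by (simp add: UNIV_bool h_def algebra_simps)
    also have "\<dots> \<le> ?g w * h w"
      using True g[of w] U(2) by (simp add: h_def less_imp_le)
    finally show ?thesis using True by simp
  next
    case False
    then show ?thesis using U0 by (simp add: UNIV_bool h_def word_weight_no_True)
  qed
  have "(\<Sum>w\<in>words UNIV n. ?g w * h w) \<le> real n + 1"
  proof (induction n)
    case 0
    show ?case by (simp add: h_def)
  next
    case (Suc n)
    have single: "{w \<in> words (UNIV :: bool set) n. True \<notin> set w} \<subseteq> {replicate n False}"
      by (auto simp: words_def intro!: replicate_eqI)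
    have "(\<Sum>w\<in>words UNIV (Suc n). ?g w * h w)
        \<le> (\<Sum>w\<in>words UNIV n. ?g w * h w + (if True \<in> set w then 0 else 1))"
      unfolding sum_words_Suc[OF finite] by (intro sum_mono step)
    also have "\<dots> = (\<Sum>w\<in>words UNIV n. ?g w * h w) + card {w \<in> words (UNIV :: bool set) n. True \<notin> set w}"
      by (simp add: sum.distrib sum.If_cases finite_words Int_def)
    also have "\<dots> \<le> real n + 1 + 1"
      using Suc card_mono[OF _ single] by simp
    finally show ?case by simp
  qed
  moreover have "(\<Sum>w\<in>words UNIV n. ?g w) \<le> (\<Sum>w\<in>words UNIV n. ?g w * h w)"
    using g U(1) by (intro sum_mono) (simp add: h_def less_imp_le)
  ultimately show ?thesis by linarith
qed

section \<open>The renewal inequality\<close>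

lemma exp_neg_inverse_le:
  fixes t :: real
  assumes "0 < t"
  shows "exp (- 2 / t) \<le> (t / (t + 1))\<^sup>2"
proof -
  have "ln ((t + 1) / t) \<le> 1 / t"
    using assms ln_le_minus_one[of "(t + 1) / t"] by (simp add: field_simps)
  then have "exp (- 1 / t) \<le> exp (- ln ((t + 1) / t))" by simp
  also have "\<dots> = t / (t + 1)" using assms by (simp add: exp_minus)
  finally have "(exp (- 1 / t))\<^sup>2 \<le> (t / (t + 1))\<^sup>2" by (intro power_mono) auto
  then show ?thesis by (simp add: exp_double[symmetric] power2_eq_square flip: exp_add)
qed

text \<open>An upper bound for \<open>exp\<close> of the potential at a point that enters the right branch after \<open>k\<close> steps:
up to time \<open>N\<close> the potential has its minimum \<open>b\<close>, beyond it the germ \<open>- 2 * \<alpha> * x powr \<alpha>\<close>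
decides, which is at most \<open>- 2 / (k + s)\<close> at such a point, for \<open>s = 2 / \<alpha>\<close>.\<close>

definition step_weight :: "real \<Rightarrow> real \<Rightarrow> nat \<Rightarrow> nat \<Rightarrow> real" where
  "step_weight b s N k = (if k \<le> N then exp b else exp (- 2 / (real k + s)))"

text \<open>With \<open>W = step_weight b s N\<close>, this bounds the series
\<open>1 + W (k + 1) + W (k + 1) * W (k + 2) + \<dots>\<close>. For \<open>k \<ge> N\<close> the weights behave like a squared
telescoping product, whose series grows linearly in \<open>k\<close>; below \<open>N\<close> the series is geometric.\<close>

definition renewal_bound :: "real \<Rightarrow> real \<Rightarrow> nat \<Rightarrow> nat \<Rightarrow> real" where
  "renewal_bound b s N k =
     (if k < N then 1 / (1 - exp b) + exp b ^ (N - k) * (real N + s + 2) else real k + s + 2)"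

lemma renewal_bound_supersolution:
  assumes "b < 0" "0 < s"
  shows "1 + step_weight b s N (Suc k) * renewal_bound b s N (Suc k) \<le> renewal_bound b s N k"
proof (cases "k < N")
  case True
  have b: "exp b < 1" using assms by simp
  have pow: "exp b * exp b ^ (N - Suc k) = exp b ^ (N - k)"
    using True by (metis Suc_diff_Suc power_Suc)
  have geo: "1 + exp b / (1 - exp b) = 1 / (1 - exp b)" using b by (simp add: field_simps)
  show ?thesis
  proof (cases "Suc k < N")
    case True
    then have "1 + step_weight b s N (Suc k) * renewal_bound b s N (Suc k)
        = 1 + exp b / (1 - exp b) + exp b * exp b ^ (N - Suc k) * (real N + s + 2)"
      by (simp add: step_weight_def renewal_bound_def algebra_simps)
    also have "\<dots> = renewal_bound b s N k"
      using \<open>k < N\<close> by (simp add: geo pow renewal_bound_def)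
    finally show ?thesis by simp
  next
    case False
    then have N: "N = Suc k" using True by simp
    have "1 \<le> 1 / (1 - exp b)" using b by (simp add: field_simps)
    then show ?thesis by (simp add: N step_weight_def renewal_bound_def)
  qed
next
  case False
  define t where "t = real k + 1 + s"
  have t: "0 < t" using assms by (simp add: t_def)
  have "exp (- 2 / t) * (t + 2) \<le> (t / (t + 1))\<^sup>2 * (t + 2)"
    using t exp_neg_inverse_le[OF t] by (intro mult_right_mono) auto
  also have "\<dots> = t * (t * (t + 2) / (t + 1)\<^sup>2)" by (simp add: power2_eq_square)
  also have "\<dots> \<le> t"
  proof (rule mult_left_le)
    have "t * (t + 2) \<le> (t + 1)\<^sup>2" by (simp add: power2_eq_square algebra_simps)
    then show "t * (t + 2) / (t + 1)\<^sup>2 \<le> 1" using t by simp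
  qed (use t in simp)
  finally show ?thesis
    using False by (simp add: step_weight_def renewal_bound_def t_def algebra_simps)
qed

lemma renewal_bound_ge_1: "b < 0 \<Longrightarrow> 0 < s \<Longrightarrow> 1 \<le> renewal_bound b s N k"
  by (auto simp: renewal_bound_def intro!: add_increasing2)

text \<open>This is where \<open>b < - ln 2\<close> enters: without the tail, \<open>exp b / (1 - exp b) < 1\<close> says that the
constant potential \<open>b\<close> on the full shift of two symbols has negative pressure \<open>b + ln 2\<close>. The
excursions near 0 that are longer than \<open>N\<close> add about \<open>N * exp (N * b)\<close>, which is small.\<close>

lemma eventually_renewal_bound_0:
  assumes b: "b < - ln 2"
  shows "eventually (\<lambda>N. exp b * renewal_bound b s N 0 < 1) sequentially"
proof -
  have b2: "exp b < 1 / 2"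
    using b exp_less_mono[of b "- ln 2"] by (simp add: exp_minus)
  have b0: "b < 0" using b2 using exp_less_one_iff[of b] by linarith
  have "(\<lambda>N. exp b * (1 / (1 - exp b) + exp b ^ N * (real N + s + 2))) \<longlonglongrightarrow> exp b * (1 / (1 - exp b) + 0)"
  proof (intro tendsto_intros)
    have "(\<lambda>N. exp (b * real N) * (real N + s + 2)) \<longlonglongrightarrow> 0" using b0 by real_asymp
    then show "(\<lambda>N. exp b ^ N * (real N + s + 2)) \<longlonglongrightarrow> 0"
      by (simp add: exp_of_nat_mult[symmetric] mult.commute)
  qed
  moreover have "exp b * (1 / (1 - exp b) + 0) < 1"
    using b2 b0 by (simp add: field_simps)
  ultimately have "eventually (\<lambda>N. exp b * (1 / (1 - exp b) + exp b ^ N * (real N + s + 2)) < 1) sequentially"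
    by (rule order_tendstoD)
  then show ?thesis
    using eventually_gt_at_top[of 0] by eventually_elim (simp add: renewal_bound_def)
qed


section \<open>Dynamics of the Manneville-Pomeau map\<close>

definition right_branch :: "real \<Rightarrow> real set" where
  "right_branch \<alpha> = {x. 1 \<le> x + x powr (1 + \<alpha>)}"

lemma manneville_pomeau_range: "manneville_pomeau \<alpha> x \<in> {0..<1}"
  by (simp add: manneville_pomeau_def frac_lt_1)

lemma manneville_pomeau_left:
  "0 \<le> x \<Longrightarrow> x \<notin> right_branch \<alpha> \<Longrightarrow> manneville_pomeau \<alpha> x = x + x powr (1 + \<alpha>)"
  by (simp add: manneville_pomeau_def right_branch_def frac_eq)

lemma powr_le_self:
  fixes x :: real
  shows "0 < \<alpha> \<Longrightarrow> 0 \<le> x \<Longrightarrow> x \<le> 1 \<Longrightarrow> x powr (1 + \<alpha>) \<le> x"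
  using powr_mono'[of 1 "1 + \<alpha>" x] by simp

lemma manneville_pomeau_right:
  assumes "0 < \<alpha>" "x \<in> {0..<1}" "x \<in> right_branch \<alpha>"
  shows "manneville_pomeau \<alpha> x = x + x powr (1 + \<alpha>) - 1"
  using assms powr_le_self[of \<alpha> x]
  by (simp add: manneville_pomeau_def right_branch_def frac_unique_iff)

lemma manneville_pomeau_mono:
  assumes "0 < \<alpha>" "x \<in> {0..<1}" "y \<in> {0..<1}" "x \<le> y"
    "x \<in> right_branch \<alpha> \<longleftrightarrow> y \<in> right_branch \<alpha>"
  shows "manneville_pomeau \<alpha> x \<le> manneville_pomeau \<alpha> y"
proof -
  have "x + x powr (1 + \<alpha>) \<le> y + y powr (1 + \<alpha>)"
    using assms by (intro add_mono powr_mono2) auto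
  then show ?thesis
    using assms by (cases "y \<in> right_branch \<alpha>") (simp_all add: manneville_pomeau_left manneville_pomeau_right)
qed

lemma measurable_manneville_pomeau:
  "manneville_pomeau \<alpha> \<in> measurable (restrict_space borel I01) (restrict_space borel I01)"
proof (rule measurable_restrict_space3)
  show "manneville_pomeau \<alpha> \<in> borel \<rightarrow>\<^sub>M borel"
    unfolding manneville_pomeau_def[abs_def] frac_def by measurable
  show "manneville_pomeau \<alpha> \<in> I01 \<rightarrow> I01"
    using manneville_pomeau_range[of \<alpha>] by (auto simp: less_imp_le)
qed

lemma right_branch_in_borel: "right_branch \<alpha> \<in> sets borel"
  unfolding right_branch_def by measurable

lemma right_branch_ge_half: "0 < \<alpha> \<Longrightarrow> 0 \<le> x \<Longrightarrow> x \<le> 1 \<Longrightarrow> x \<in> right_branch \<alpha> \<Longrightarrow> 1 / 2 \<le> x"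
  using powr_le_self[of \<alpha> x] by (simp add: right_branch_def)

text \<open>In the coordinate \<open>x powr - \<alpha>\<close> the left branch moves a point down by at most \<open>\<alpha>\<close>, because of
\<open>(1 + u) powr \<alpha> \<le> 1 + \<alpha> * u\<close> for \<open>u = x powr \<alpha>\<close>.\<close>

lemma neg_powr_step:
  fixes \<alpha> x :: real
  assumes \<alpha>: "0 < \<alpha>" "\<alpha> < 1" and x: "0 < x"
  shows "x powr - \<alpha> \<le> (x + x powr (1 + \<alpha>)) powr - \<alpha> + \<alpha>"
proof -
  define y where "y = x + x powr (1 + \<alpha>)"
  define u where "u = x powr \<alpha>"
  have u: "0 < u" using x powr_gt_zero[of x \<alpha>] by (simp add: u_def)
  have y: "y = x * (1 + u)" using x by (simp add: y_def u_def powr_add algebra_simps)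
  have y0: "0 < y" "x \<le> y" using x by (auto simp: y_def intro!: add_pos_nonneg)
  have "(1 + u) powr \<alpha> \<le> 1 + \<alpha> * u"
    using Youngs_inequality_0[of \<alpha> "1 - \<alpha>" "1 + u" 1] \<alpha> u by (simp add: algebra_simps)
  then have "y powr - \<alpha> * (1 + u) powr \<alpha> \<le> y powr - \<alpha> * (1 + \<alpha> * u)"
    by (intro mult_left_mono) auto
  moreover have "y powr - \<alpha> * (1 + u) powr \<alpha> = x powr - \<alpha>"
  proof -
    have "y powr - \<alpha> = x powr - \<alpha> * (1 + u) powr - \<alpha>"
      unfolding y by (subst powr_mult) (use x u in auto)
    then show ?thesis using u by (simp add: powr_minus)
  qed
  moreover have "y powr - \<alpha> * u \<le> x powr - \<alpha> * u"
    using y0 x \<alpha> u by (intro mult_right_mono powr_mono2') auto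
  moreover have "x powr - \<alpha> * u = 1" using x by (simp add: u_def powr_minus)
  ultimately have "x powr - \<alpha> \<le> y powr - \<alpha> + \<alpha> * (y powr - \<alpha> * u)" "y powr - \<alpha> * u \<le> 1"
    by (simp_all add: algebra_simps)
  moreover have "\<alpha> * (y powr - \<alpha> * u) \<le> \<alpha> * 1"
    using calculation(2) \<alpha> by (intro mult_left_mono) auto
  ultimately show ?thesis by (simp add: y_def)
qed

text \<open>Points of the right branch lie above \<open>1/2\<close>, where \<open>x powr - \<alpha> \<le> 2\<close>. Going back along the left
branch, a point that needs \<open>k\<close> steps to leave it cannot be too close to 0, and the potential
there is correspondingly small.\<close>

lemma neg_powr_le_waiting_time:
  assumes \<alpha>: "0 < \<alpha>" "\<alpha> < 1" and x: "x \<in> {0..<1}"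
    and w: "w = itinerary (\<lambda>x. x \<in> right_branch \<alpha>) (manneville_pomeau \<alpha>) n x" "True \<in> set w"
  shows "0 < x \<and> x powr - \<alpha> \<le> 2 + \<alpha> * length (takeWhile Not w)"
  using x w
proof (induction n arbitrary: x w)
  case (Suc n)
  let ?f = "manneville_pomeau \<alpha>"
  show ?case
  proof (cases "x \<in> right_branch \<alpha>")
    case True
    then have half: "1 / 2 \<le> x" using right_branch_ge_half[of \<alpha> x] \<alpha> Suc.prems by auto
    then have "x powr - \<alpha> \<le> (1 / 2) powr - \<alpha>" using \<alpha> by (intro powr_mono2') auto
    also have "\<dots> = 2 powr \<alpha>" by (simp add: powr_minus powr_divide)
    also have "\<dots> \<le> 2 powr 1" using \<alpha> by (intro powr_mono) auto
    finally show ?thesis using half True Suc.prems by simp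
  next
    case False
    define v where "v = itinerary (\<lambda>x. x \<in> right_branch \<alpha>) ?f n (?f x)"
    have w: "w = False # v" using Suc.prems False by (simp add: v_def)
    have fx: "?f x = x + x powr (1 + \<alpha>)" using Suc.prems False by (simp add: manneville_pomeau_left)
    have IH: "0 < ?f x \<and> ?f x powr - \<alpha> \<le> 2 + \<alpha> * length (takeWhile Not v)"
      using Suc.IH[OF manneville_pomeau_range v_def] Suc.prems w by simp
    have x0: "0 < x" using IH Suc.prems fx by (cases "x = 0") auto
    show ?thesis
      using neg_powr_step[OF \<alpha> x0] IH x0 by (simp add: w fx algebra_simps)
  qed
qed simp

lemma hits_right_branch:
  assumes \<alpha>: "0 < \<alpha>" and x: "x \<in> {0<..<1}"
  shows "\<exists>n. (manneville_pomeau \<alpha> ^^ n) x \<in> right_branch \<alpha>"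
proof (rule ccontr)
  let ?f = "manneville_pomeau \<alpha>" and ?u = "x powr (1 + \<alpha>)"
  assume *: "\<nexists>n. (?f ^^ n) x \<in> right_branch \<alpha>"
  have grow: "x + real n * ?u \<le> (?f ^^ n) x" for n
  proof (induction n)
    case (Suc n)
    have ge: "x \<le> (?f ^^ n) x"
      using Suc by (smt (verit) mult_nonneg_nonneg of_nat_0_le_iff powr_ge_zero)
    then have "?f ((?f ^^ n) x) = (?f ^^ n) x + (?f ^^ n) x powr (1 + \<alpha>)"
      using * x by (intro manneville_pomeau_left) auto
    moreover have "?u \<le> (?f ^^ n) x powr (1 + \<alpha>)"
      using ge x \<alpha> by (intro powr_mono2) auto
    ultimately show ?case using Suc by (simp add: algebra_simps)
  qed simp
  have "0 < ?u" using x by simp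
  then obtain n where n: "1 < real n * ?u" using reals_Archimedean3 by blast
  have "(?f ^^ n) x < 1"
    using x manneville_pomeau_range[of \<alpha>] by (cases n) auto
  then show False using grow[of n] n x by auto
qed

text \<open>Every orbit in the open interval reaches the right branch, so the preimages of the right branch
cover the open interval.\<close>

lemma invariant_measure_right_branch_null:
  assumes \<alpha>: "0 < \<alpha>"
    and M: "sets M = sets (restrict_space borel I01)" "manneville_pomeau \<alpha> \<in> measurable M M"
    "distr M M (manneville_pomeau \<alpha>) = M"
    and null: "emeasure M (right_branch \<alpha> \<inter> I01) = 0"
  shows "emeasure M {0<..<1} = 0"
proof -
  let ?f = "manneville_pomeau \<alpha>" and ?R = "right_branch \<alpha> \<inter> I01"
  have sp: "space M = I01" using sets_eq_imp_space_eq[OF M(1)] by (simp add: space_restrict_space)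
  have R: "?R \<in> sets M" using right_branch_in_borel M(1) by (auto simp: sets_restrict_space_iff)
  define H where "H = (\<lambda>n. (?f ^^ n) -` ?R \<inter> space M)"
  have H: "H n \<in> null_sets M" for n
  proof (induction n)
    case 0
    have "H 0 = ?R" using sp by (auto simp: H_def)
    then show ?case using null R by auto
  next
    case (Suc n)
    have eq: "H (Suc n) = ?f -` H n \<inter> space M"
      using measurable_space[OF M(2)] by (auto simp: H_def funpow_swap1)
    have "H n \<in> sets M" "emeasure M (H n) = 0" using Suc by auto
    then show ?case
      unfolding eq using emeasure_distr[OF M(2), of "H n"] measurable_sets[OF M(2), of "H n"] M(3)
      by (simp add: null_sets_def)
  qed
  have "{0<..<1} \<subseteq> (\<Union>n. H n)"
  proof
    fix x :: real assume x: "x \<in> {0<..<1}"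
    then obtain n where "(?f ^^ n) x \<in> right_branch \<alpha>" using hits_right_branch[OF \<alpha>] by blast
    moreover have "(?f ^^ n) x \<in> I01"
      using x manneville_pomeau_range[of \<alpha>] by (cases n) (auto simp: less_imp_le)
    ultimately show "x \<in> (\<Union>n. H n)" using x sp by (auto simp: H_def)
  qed
  moreover have "(\<Union>n. H n) \<in> null_sets M" using H by (intro null_sets_UN) auto
  moreover have "{0<..<1} \<in> sets M" using M(1) by (auto simp: sets_restrict_space_iff)
  ultimately show ?thesis using null_sets_subset by blast
qed


section \<open>The potential\<close>

text \<open>The solution of \<open>x powr - \<alpha> = 2 + \<alpha> * N\<close>: all points that reach the right branch within \<open>N\<close>
steps lie on its right or coincide with it.\<close>

definition cutoff :: "real \<Rightarrow> nat \<Rightarrow> real" where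
  "cutoff \<alpha> N = (2 + \<alpha> * N) powr (- 1 / \<alpha>)"

text \<open>The required germ at 0, pushed down to the value \<open>b\<close> by a linear term that acts from half the
cutoff on and, since it alone equals \<open>b\<close> at the cutoff, has finished its work there.\<close>

definition potential :: "real \<Rightarrow> real \<Rightarrow> nat \<Rightarrow> real \<Rightarrow> real" where
  "potential \<alpha> b N x =
     max b (- 2 * \<alpha> * x powr \<alpha> + 2 * b / cutoff \<alpha> N * max 0 (x - cutoff \<alpha> N / 2))"

lemma cutoff_bounds:
  assumes "0 < \<alpha>"
  shows "0 < cutoff \<alpha> N" "cutoff \<alpha> N \<le> 1"
proof -
  have pos: "0 < 2 + \<alpha> * N" using assms by (simp add: add_pos_nonneg)
  then show "0 < cutoff \<alpha> N" by (simp add: cutoff_def)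
  have "(2 + \<alpha> * N) powr (- 1 / \<alpha>) \<le> 1 powr (- 1 / \<alpha>)"
    using assms by (intro powr_mono2') auto
  then show "cutoff \<alpha> N \<le> 1" by (simp add: cutoff_def)
qed

lemma cutoff_le:
  assumes "0 < \<alpha>" "0 < x" "x powr - \<alpha> \<le> 2 + \<alpha> * N"
  shows "cutoff \<alpha> N \<le> x"
proof -
  have "(2 + \<alpha> * N) powr (- 1 / \<alpha>) \<le> (x powr - \<alpha>) powr (- 1 / \<alpha>)"
    using assms by (intro powr_mono2') auto
  also have "\<dots> = x" using assms by (simp add: powr_powr)
  finally show ?thesis by (simp add: cutoff_def)
qed

lemma cutoff_powr:
  assumes "0 < \<alpha>"
  shows "cutoff \<alpha> N powr \<alpha> = 1 / (2 + \<alpha> * N)"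
proof -
  have "0 < 2 + \<alpha> * N" using assms by (simp add: add_pos_nonneg)
  moreover have "- 1 / \<alpha> * \<alpha> = - 1" using assms by simp
  ultimately show ?thesis by (simp only: cutoff_def powr_powr) (simp add: powr_minus_divide)
qed

lemma potential_right_of_cutoff:
  assumes \<alpha>: "0 < \<alpha>" and b: "b < 0" and x: "cutoff \<alpha> N \<le> x"
  shows "potential \<alpha> b N x = b"
proof -
  let ?p = "cutoff \<alpha> N"
  have p: "0 < ?p" using cutoff_bounds \<alpha> by blast
  have "2 * b / ?p * max 0 (x - ?p / 2) \<le> 2 * b / ?p * (?p / 2)"
    using p b x by (intro mult_left_mono_neg) (auto simp: divide_nonpos_pos)
  also have "\<dots> = b" using p by simp
  finally have "2 * b / ?p * max 0 (x - ?p / 2) \<le> b" .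
  moreover have "- 2 * \<alpha> * x powr \<alpha> \<le> 0" using \<alpha> by simp
  ultimately have "- 2 * \<alpha> * x powr \<alpha> + 2 * b / ?p * max 0 (x - ?p / 2) \<le> b" by linarith
  then show ?thesis by (simp add: potential_def)
qed

lemma potential_le:
  assumes "0 < \<alpha>" "b < 0"
  shows "potential \<alpha> b N x \<le> max b (- 2 * \<alpha> * x powr \<alpha>)"
proof -
  have "2 * b / cutoff \<alpha> N * max 0 (x - cutoff \<alpha> N / 2) \<le> 0"
    using assms cutoff_bounds(1)[of \<alpha> N] divide_nonpos_pos[of "2 * b" "cutoff \<alpha> N"]
    by (intro mult_nonpos_nonneg) auto
  then show ?thesis by (auto simp: potential_def)
qed

lemma potential_nonpos:
  assumes "0 < \<alpha>" "b < 0"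
  shows "potential \<alpha> b N x \<le> 0"
proof -
  have "- 2 * \<alpha> * x powr \<alpha> \<le> 0" using assms by simp
  then show ?thesis using potential_le[OF assms, of N x] assms by linarith
qed

lemma potential_ge: "b \<le> potential \<alpha> b N x"
  by (simp add: potential_def)

text \<open>Because of \<open>2 / \<alpha> > 2\<close> the right-hand side is at least \<open>- 2 / 3 \<ge> - ln 2\<close>. So truncating the
potential at \<open>b\<close> affects neither the germ near 0 nor the bounds on it along an escaping orbit.\<close>

lemma weight_exponent_ge:
  assumes "0 < \<alpha>" "\<alpha> < 1" "b < - ln 2" "1 \<le> k"
  shows "b \<le> - 2 / (real k + 2 / \<alpha>)"
proof -
  have "2 < 2 / \<alpha>" using assms by (simp add: field_simps)
  then have "2 / (real k + 2 / \<alpha>) \<le> 2 / 3" using assms by (intro divide_left_mono) auto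
  then show ?thesis using ln2_ge_two_thirds assms by simp
qed

lemma potential_near_0:
  assumes \<alpha>: "0 < \<alpha>" "\<alpha> < 1" and b: "b < - ln 2" and N: "1 \<le> N"
    and x: "0 \<le> x" "x < cutoff \<alpha> N / 2"
  shows "potential \<alpha> b N x = - 2 * \<alpha> * x powr \<alpha>"
proof -
  have "x powr \<alpha> \<le> cutoff \<alpha> N powr \<alpha>" using x \<alpha> cutoff_bounds[of \<alpha> N] by (intro powr_mono2) auto
  then have "2 * \<alpha> * x powr \<alpha> \<le> 2 * \<alpha> * (1 / (2 + \<alpha> * N))"
    using \<alpha> by (intro mult_left_mono) (simp_all add: cutoff_powr)
  also have "\<dots> = 2 / (real N + 2 / \<alpha>)" using \<alpha> by (simp add: field_simps)
  also have "\<dots> \<le> - b" using weight_exponent_ge[OF \<alpha> b N] by simp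
  finally show ?thesis using x by (simp add: potential_def)
qed

lemma powr_holder:
  fixes x y :: real
  assumes "0 < \<alpha>" "\<alpha> < 1" "0 \<le> x" "0 \<le> y"
  shows "\<bar>x powr \<alpha> - y powr \<alpha>\<bar> \<le> \<bar>x - y\<bar> powr \<alpha>"
proof -
  have *: "x powr \<alpha> \<le> y powr \<alpha> + (x - y) powr \<alpha>" if "0 \<le> y" "y \<le> x" for x y :: real
  proof (cases "x = 0")
    case False
    then have x: "0 < x" using that by simp
    have "y / x \<le> (y / x) powr \<alpha>" "(x - y) / x \<le> ((x - y) / x) powr \<alpha>"
      using powr_mono'[of \<alpha> 1 "y / x"] powr_mono'[of \<alpha> 1 "(x - y) / x"] that x assms by auto
    moreover have "y / x + (x - y) / x = 1" using x by (simp add: field_simps)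
    ultimately have "1 \<le> (y powr \<alpha> + (x - y) powr \<alpha>) / x powr \<alpha>"
      using that x by (simp add: powr_divide add_divide_distrib)
    then show ?thesis using x by (simp add: field_simps)
  qed (use that in simp)
  show ?thesis
  proof (cases "y \<le> x")
    case True
    then have "y powr \<alpha> \<le> x powr \<alpha>" using assms by (intro powr_mono2) auto
    then show ?thesis using *[OF assms(4) True] True by simp
  next
    case False
    then have "x powr \<alpha> \<le> y powr \<alpha>" using assms by (intro powr_mono2) auto
    then show ?thesis using *[of x y] *[of y x] assms False by simp
  qed
qed

lemma potential_holder:
  assumes \<alpha>: "0 < \<alpha>" "\<alpha> < 1" and b: "b < 0"
  shows "holder_on {0..1} (potential \<alpha> b N)"
proof -
  define c where "c = - 2 * b / cutoff \<alpha> N"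
  have c: "0 \<le> c" using b cutoff_bounds(1)[of \<alpha> N] \<alpha> divide_nonpos_pos[of "2 * b" "cutoff \<alpha> N"]
    by (simp add: c_def)
  have "\<bar>potential \<alpha> b N x - potential \<alpha> b N y\<bar> \<le> (2 * \<alpha> + c) * \<bar>x - y\<bar> powr \<alpha>"
    if "x \<in> {0..1}" "y \<in> {0..1}" for x y
  proof -
    let ?m = "\<lambda>x. max 0 (x - cutoff \<alpha> N / 2)"
    have pot: "potential \<alpha> b N x = max b (- (2 * \<alpha> * x powr \<alpha>) - c * ?m x)" for x
      by (simp add: potential_def c_def)
    have "\<bar>potential \<alpha> b N x - potential \<alpha> b N y\<bar>
        \<le> \<bar>2 * \<alpha> * x powr \<alpha> - 2 * \<alpha> * y powr \<alpha>\<bar> + \<bar>c * ?m x - c * ?m y\<bar>"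
    proof -
      have "\<bar>max b u - max b v\<bar> \<le> \<bar>u - v\<bar>" for u v :: real by linarith
      moreover have "\<bar>(- p - q) - (- p' - q')\<bar> \<le> \<bar>p - p'\<bar> + \<bar>q - q'\<bar>" for p q p' q' :: real
        by linarith
      ultimately show ?thesis unfolding pot by (rule order_trans)
    qed
    also have "\<dots> = 2 * \<alpha> * \<bar>x powr \<alpha> - y powr \<alpha>\<bar> + c * \<bar>?m x - ?m y\<bar>"
      using \<alpha> c by (simp add: abs_mult right_diff_distrib[symmetric])
    also have "\<dots> \<le> 2 * \<alpha> * \<bar>x - y\<bar> powr \<alpha> + c * \<bar>x - y\<bar> powr \<alpha>"
    proof (intro add_mono mult_left_mono)
      have "\<bar>?m x - ?m y\<bar> \<le> \<bar>x - y\<bar>" by linarith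
      also have "\<dots> \<le> \<bar>x - y\<bar> powr \<alpha>"
        using powr_mono'[of \<alpha> 1 "\<bar>x - y\<bar>"] \<alpha> that by auto
      finally show "\<bar>?m x - ?m y\<bar> \<le> \<bar>x - y\<bar> powr \<alpha>" .
    qed (use \<alpha> c powr_holder that in auto)
    finally show ?thesis by (simp add: algebra_simps)
  qed
  then show ?thesis
    unfolding holder_on_def using \<alpha> by (intro exI[of _ \<alpha>] exI[of _ "2 * \<alpha> + c"]) auto
qed

lemma potential_oscillation:
  assumes \<alpha>: "0 < \<alpha>" and b: "b < 0"
  shows "(SUP x\<in>{0..1}. potential \<alpha> b N x) - (INF x\<in>{0..1}. potential \<alpha> b N x) = \<bar>b\<bar>"
proof -
  have "potential \<alpha> b N 0 = 0"
    using b cutoff_bounds(1)[OF \<alpha>, of N] by (simp add: potential_def)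
  then have "(SUP x\<in>{0..1}. potential \<alpha> b N x) = 0"
    using potential_nonpos[OF \<alpha> b] by (intro cSup_eq_maximum) (auto simp: image_iff intro: bexI[of _ 0])
  moreover have "potential \<alpha> b N 1 = b"
    using cutoff_bounds[OF \<alpha>] by (intro potential_right_of_cutoff \<alpha> b)
  then have "(INF x\<in>{0..1}. potential \<alpha> b N x) = b"
    using potential_ge by (intro cInf_eq_minimum) (auto simp: image_iff intro: bexI[of _ 1])
  ultimately show ?thesis using b by simp
qed

lemma integrable_potential:
  assumes \<alpha>: "0 < \<alpha>" and b: "b < 0"
    and M: "prob_space M" "sets M = sets (restrict_space borel I01)"
  shows "integrable M (potential \<alpha> b N)"
proof -
  interpret prob_space M by fact
  have "potential \<alpha> b N \<in> borel_measurable borel"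
    unfolding potential_def[abs_def] by measurable
  then have "potential \<alpha> b N \<in> borel_measurable M"
    by (subst measurable_cong_sets[OF M(2) refl]) (rule measurable_restrict_space1)
  moreover have "\<bar>potential \<alpha> b N x\<bar> \<le> \<bar>b\<bar>" for x
    using potential_nonpos[OF \<alpha> b, of N x] potential_ge[of b \<alpha> N x] by simp
  ultimately show ?thesis by (intro integrable_const_bound[where B = "\<bar>b\<bar>"]) auto
qed

section \<open>The free energy gap\<close>

lemma potential_le_step_weight:
  assumes \<alpha>: "0 < \<alpha>" "\<alpha> < 1" and b: "b < - ln 2" and k: "1 \<le> k"
    and x: "0 < x" "x powr - \<alpha> \<le> 2 + \<alpha> * real k"
  shows "exp (potential \<alpha> b N x) \<le> step_weight b (2 / \<alpha>) N k"
proof (cases "k \<le> N")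
  case True
  have "\<alpha> * real k \<le> \<alpha> * real N" using True \<alpha> by simp
  then have "cutoff \<alpha> N \<le> x" using x by (intro cutoff_le[OF \<alpha>(1)]) auto
  moreover have "b < 0" using b ln_gt_zero[of 2] by linarith
  ultimately show ?thesis using potential_right_of_cutoff \<alpha> True by (simp add: step_weight_def)
next
  case False
  have b0: "b < 0" using b ln_gt_zero[of 2] by linarith
  have pos: "0 < 2 + \<alpha> * real k" using \<alpha> by (simp add: add_pos_nonneg)
  have "1 / (2 + \<alpha> * real k) \<le> x powr \<alpha>"
    using x pos by (simp add: powr_minus field_simps)
  then have "2 * \<alpha> * (1 / (2 + \<alpha> * real k)) \<le> 2 * \<alpha> * x powr \<alpha>"
    using \<alpha> by (intro mult_left_mono) auto
  moreover have "2 * \<alpha> * (1 / (2 + \<alpha> * real k)) = 2 / (real k + 2 / \<alpha>)"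
    using \<alpha> by (simp add: field_simps)
  ultimately have "potential \<alpha> b N x \<le> - 2 / (real k + 2 / \<alpha>)"
    using potential_le[OF \<alpha>(1) b0, of N x] weight_exponent_ge[OF \<alpha> b k] by auto
  then show ?thesis using False by (simp add: step_weight_def)
qed

text \<open>The spare factor \<open>1 / (exp b * U\<^sub>0)\<close>, which exceeds 1 when \<open>N\<close> is large, is given to the right
branch: there \<open>exp \<psi>\<close> is exactly the weight \<open>1 / U\<^sub>0\<close> that the renewal inequality allows for the
letter \<open>True\<close>.\<close>

lemma orbit_weight_le_word_weight:
  fixes N :: nat
  assumes \<alpha>: "0 < \<alpha>" "\<alpha> < 1" and b: "b < - ln 2" and x: "x \<in> {0..<1}"
  defines "W \<equiv> step_weight b (2 / \<alpha>) N" and "U\<^sub>0 \<equiv> renewal_bound b (2 / \<alpha>) N 0"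
  defines "\<psi> \<equiv> \<lambda>x. potential \<alpha> b N x + - ln (exp b * U\<^sub>0) * indicator (right_branch \<alpha>) x"
  shows "exp (\<Sum>i<n. \<psi> ((manneville_pomeau \<alpha> ^^ i) x))
    \<le> word_weight W (1 / U\<^sub>0) (itinerary (\<lambda>x. x \<in> right_branch \<alpha>) (manneville_pomeau \<alpha>) n x)"
  using x
proof (induction n arbitrary: x)
  case (Suc n)
  let ?f = "manneville_pomeau \<alpha>"
  have b0: "b < 0" using b ln_gt_zero[of 2] by linarith
  have U0: "1 \<le> U\<^sub>0" unfolding U\<^sub>0_def using \<alpha> b0 by (intro renewal_bound_ge_1) auto
  define w where "w = itinerary (\<lambda>x. x \<in> right_branch \<alpha>) ?f n (?f x)"
  define y where "y \<longleftrightarrow> x \<in> right_branch \<alpha>"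
  have word: "y # w = itinerary (\<lambda>x. x \<in> right_branch \<alpha>) ?f (Suc n) x"
    by (simp add: w_def y_def)
  have time: "0 < x \<and> x powr - \<alpha> \<le> 2 + \<alpha> * length (takeWhile Not (y # w))" if "True \<in> set (y # w)"
    by (rule neg_powr_le_waiting_time[OF \<alpha> Suc.prems word that])
  have step: "exp (\<psi> x)
      \<le> (if y then 1 / U\<^sub>0 else if True \<in> set w then W (Suc (length (takeWhile Not w))) else 1)"
  proof (cases y)
    case True
    then have "cutoff \<alpha> N \<le> x"
      using time \<alpha> by (intro cutoff_le) (auto simp: add_increasing2)
    then have "\<psi> x = b - ln (exp b * U\<^sub>0)"
      using potential_right_of_cutoff[OF \<alpha>(1) b0] True by (simp add: \<psi>_def y_def)
    then have "exp (\<psi> x) = exp b / exp (ln (exp b * U\<^sub>0))" by (simp only: exp_diff)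
    also have "\<dots> = 1 / U\<^sub>0" using U0 by simp
    finally show ?thesis using True by simp
  next
    case False
    then have \<psi>: "\<psi> x = potential \<alpha> b N x" by (simp add: \<psi>_def y_def)
    show ?thesis
    proof (cases "True \<in> set w")
      case True
      then show ?thesis
        using False time potential_le_step_weight[OF \<alpha> b, of "Suc (length (takeWhile Not w))" x N]
        by (simp add: \<psi> W_def)
    next
      case no: False
      then show ?thesis using False potential_nonpos[OF \<alpha>(1) b0] by (simp add: \<psi>)
    qed
  qed
  have "exp (\<Sum>i<Suc n. \<psi> ((?f ^^ i) x)) = exp (\<Sum>i<n. \<psi> ((?f ^^ i) (?f x))) * exp (\<psi> x)"
    by (simp add: sum.lessThan_Suc_shift funpow_swap1 exp_add[symmetric] add.commute
        del: sum.lessThan_Suc)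
  also have "\<dots> \<le> word_weight W (1 / U\<^sub>0) w * exp (\<psi> x)"
    using Suc.IH[OF manneville_pomeau_range] by (intro mult_right_mono) (auto simp: w_def)
  also have "\<dots> \<le> word_weight W (1 / U\<^sub>0) (y # w)"
    unfolding word_weight.simps(2)
    using step U0 by (intro mult_left_mono less_imp_le[OF word_weight_pos])
      (auto simp: W_def step_weight_def)
  finally show ?case by (simp only: word)
qed simp

text \<open>The point 1 is not in the image of the map, hence carries no invariant mass. It has to be discarded
because the map jumps down to 0 there.\<close>

lemma invariant_measure_point_1:
  assumes M: "sets M = sets (restrict_space borel I01)" "manneville_pomeau \<alpha> \<in> measurable M M"
    "distr M M (manneville_pomeau \<alpha>) = M"
  shows "AE x in M. x \<in> {0..<1}"
proof -
  let ?f = "manneville_pomeau \<alpha>"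
  have sp: "space M = I01" using sets_eq_imp_space_eq[OF M(1)] by (simp add: space_restrict_space)
  have 1: "{1} \<in> sets M" using M(1) by (auto simp: sets_restrict_space_iff)
  have "emeasure M {1} = emeasure M (?f -` {1} \<inter> space M)"
    using emeasure_distr[OF M(2) 1] M(3) by simp
  also have "?f -` {1} \<inter> space M = {}"
  proof -
    have "?f x \<noteq> 1" for x using manneville_pomeau_range[of \<alpha> x] by auto
    then show ?thesis by auto
  qed
  finally have "{1} \<in> null_sets M" using 1 by auto
  then show ?thesis by (rule AE_I') (auto simp: sp)
qed

text \<open>The logarithm is negative for large \<open>N\<close>, so the free energy of an invariant measure is
negative in proportion to the time that it spends in the right branch.\<close>

theorem free_energy_potential_le:
  assumes \<alpha>: "0 < \<alpha>" "\<alpha> < 1" and b: "b < - ln 2"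
    and M: "prob_space M" "sets M = sets (restrict_space borel I01)"
    "manneville_pomeau \<alpha> \<in> measurable M M" "distr M M (manneville_pomeau \<alpha>) = M"
  shows "free_energy (manneville_pomeau \<alpha>) (potential \<alpha> b N) M
    \<le> ereal (ln (exp b * renewal_bound b (2 / \<alpha>) N 0) * measure M (right_branch \<alpha> \<inter> I01))"
proof -
  interpret prob_space M by fact
  let ?f = "manneville_pomeau \<alpha>" and ?R = "right_branch \<alpha>"
  define U where "U = renewal_bound b (2 / \<alpha>) N"
  define W where "W = step_weight b (2 / \<alpha>) N"
  define \<delta> where "\<delta> = - ln (exp b * U 0)"
  define \<psi> where "\<psi> = (\<lambda>x. potential \<alpha> b N x + \<delta> * indicator ?R x)"
  have b0: "b < 0" using b ln_gt_zero[of 2] by linarith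
  have sp: "space M = I01" using sets_eq_imp_space_eq[OF M(2)] by (simp add: space_restrict_space)
  have R: "?R \<inter> I01 \<in> sets M" using right_branch_in_borel M(2) by (auto simp: sets_restrict_space_iff)
  note pot = integrable_potential[OF \<alpha>(1) b0 M(1,2), of N]
  have ind: "indicator ?R x = (indicator (?R \<inter> I01) x :: real)" if "x \<in> space M" for x
    using that sp by (simp add: indicator_def)
  have int_ind: "integrable M (indicator ?R :: real \<Rightarrow> real)"
    using R by (subst Bochner_Integration.integrable_cong[OF refl ind]) (auto simp: less_top[symmetric])
  have \<psi>_int: "integrable M \<psi>"
    unfolding \<psi>_def using pot int_ind by (intro Bochner_Integration.integrable_add integrable_mult_right)
  have "(\<integral>x. indicator ?R x \<partial>M) = measure M (?R \<inter> I01)"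
    using R sets.sets_into_space[OF R] by (subst Bochner_Integration.integral_cong[OF refl ind]) (auto simp: Int_absorb2)
  then have \<psi>_integral: "(\<integral>x. \<psi> x \<partial>M) = (\<integral>x. potential \<alpha> b N x \<partial>M) + \<delta> * measure M (?R \<inter> I01)"
    unfolding \<psi>_def using pot int_ind by simp
  have "ks_entropy M ?f \<le> ereal (- (\<integral>x. \<psi> x \<partial>M))"
  proof (rule ks_entropy_le_of_word_weights[where B = "{0..<1}" and L = UNIV
        and \<sigma> = "\<lambda>x. x \<in> ?R" and G = "word_weight W (1 / U 0)"])
    have U1: "1 \<le> U k" for k unfolding U_def using \<alpha> b0 by (intro renewal_bound_ge_1) auto
    have W: "0 < W k" for k by (simp add: W_def step_weight_def)
    show "0 < word_weight W (1 / U 0) w" for w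
      using W U1[of 0] by (intro word_weight_pos) auto
    show "(\<Sum>w\<in>words UNIV n. word_weight W (1 / U 0) w) \<le> real n + 1" for n
      using W U1 renewal_bound_supersolution[OF b0, of "2 / \<alpha>" N] \<alpha>
      by (intro sum_word_weight_le) (auto simp: U_def W_def)
    show "exp (\<Sum>i<n. \<psi> ((?f ^^ i) x)) \<le> word_weight W (1 / U 0) (itinerary (\<lambda>x. x \<in> ?R) ?f n x)"
      if "x \<in> {0..<1}" for n x
      using orbit_weight_le_word_weight[OF \<alpha> b that, of N n] by (simp add: \<psi>_def \<delta>_def U_def W_def)
    show "AE x in M. x \<in> {0..<1}" using invariant_measure_point_1[OF M(2-4)] .
    show "?f x \<le> ?f y" if "x \<in> {0..<1}" "y \<in> {0..<1}" "x \<le> y" "(x \<in> ?R) = (y \<in> ?R)" for x y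
      using manneville_pomeau_mono[OF \<alpha>(1) that] .
    show "?f \<in> {0..<1} \<rightarrow> {0..<1}" using manneville_pomeau_range by blast
  qed (use M \<psi>_int in auto)
  then have "free_energy ?f (potential \<alpha> b N) M
      \<le> ereal (- (\<integral>x. \<psi> x \<partial>M)) + ereal (\<integral>x. potential \<alpha> b N x \<partial>M)"
    unfolding free_energy_def by (rule add_right_mono)
  then show ?thesis by (simp add: \<psi>_integral \<delta>_def U_def)
qed

text \<open>Witnessed by the point mass at the fixed point 0, where the potential vanishes.\<close>

lemma pressure_potential_nonneg:
  assumes \<alpha>: "0 < \<alpha>" and b: "b < 0"
  shows "0 \<le> pressure (manneville_pomeau \<alpha>) (potential \<alpha> b N)"
proof -
  let ?f = "manneville_pomeau \<alpha>"
  define S where "S = restrict_space (borel :: real measure) I01"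
  define M where "M = return S 0"
  have 0: "0 \<in> space S" by (simp add: S_def space_restrict_space)
  have sets: "sets M = sets (restrict_space borel I01)" by (simp add: M_def S_def)
  have M: "prob_space M" unfolding M_def by (rule prob_space_return[OF 0])
  have fS: "?f \<in> measurable S S" unfolding S_def by (rule measurable_manneville_pomeau)
  then have f: "?f \<in> measurable M M"
    unfolding M_def by (simp cong: measurable_cong_sets)
  have f0: "?f 0 = 0" by (simp add: manneville_pomeau_def)
  have "distr M M ?f = distr M S ?f" by (rule distr_cong) (simp_all add: M_def)
  then have inv: "distr M M ?f = M"
    using distr_return[OF fS 0] f0 by (simp add: M_def)
  have erg: "M \<in> ergodic_measures ?f"
    unfolding ergodic_measures_def using M sets f inv by (auto simp: M_def indicator_def)
  note int = integrable_potential[OF \<alpha> b M sets, of N]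
  have "potential \<alpha> b N 0 = 0"
    using b cutoff_bounds(1)[OF \<alpha>, of N] by (simp add: potential_def)
  moreover have "potential \<alpha> b N \<in> borel_measurable S"
    using int by (auto simp: M_def dest: borel_measurable_integrable)
  ultimately have "(\<integral>x. potential \<alpha> b N x \<partial>M) = 0"
    unfolding M_def by (subst integral_return[OF 0]) auto
  then have "0 \<le> free_energy ?f (potential \<alpha> b N) M"
    unfolding free_energy_def using ks_entropy_nonneg[OF M f] by simp
  also have "\<dots> \<le> pressure ?f (potential \<alpha> b N)"
    unfolding pressure_def using erg int by (intro SUP_upper) auto
  finally show ?thesis .
qed

section \<open>Inducing schemes see only the open interval\<close>

lemma domains_subset_unit_interval:
  assumes "D \<in> domains (manneville_pomeau \<alpha>)"
  shows "D \<subseteq> I01"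
proof -
  let ?f = "manneville_pomeau \<alpha>"
  have "C \<subseteq> S" if "C \<in> refinement S T P n" for C S T and P :: "real set set" and n
    using that by (induction n arbitrary: C) (auto simp: join_def)
  moreover have "(?f ^^ n) x \<in> I01" if "x \<in> I01" for x n
    using that manneville_pomeau_range[of \<alpha>] by (cases n) (auto simp: less_imp_le)
  ultimately show ?thesis using assms unfolding domains_def cylinders_def by blast
qed

text \<open>Compact containment in a domain of the tower keeps the base of a scheme away from the endpoints of
the unit interval, in particular from the fixed point 0.\<close>

lemma first_return_scheme_base:
  assumes "first_return_scheme (manneville_pomeau \<alpha>) X \<X> \<tau>"
  shows "X \<subseteq> {0<..<1}"
proof -
  obtain \<E> D where D: "transitive_part (manneville_pomeau \<alpha>) \<E>" "D \<in> \<E>" "closure X \<subseteq> interior D"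
    using assms unfolding first_return_scheme_def by blast
  then have "D \<subseteq> I01" by (auto simp: transitive_part_def intro!: domains_subset_unit_interval)
  then have "interior D \<subseteq> interior I01" by (rule interior_mono)
  also have "interior I01 = {0<..<1}" by simp
  finally show ?thesis using D(3) closure_subset[of X] by blast
qed

section \<open>Potentials without liftable equilibrium states\<close>

theorem proposition2:
  fixes \<alpha> b :: real
  assumes "0 < \<alpha>" and "\<alpha> < 1" and "b < - ln 2"
  shows "\<exists>\<phi> :: real \<Rightarrow> real.
    holder_on {0..1} \<phi> \<and>
    (SUP x\<in>{0..1}. \<phi> x) - (INF x\<in>{0..1}. \<phi> x) = \<bar>b\<bar> \<and>
    (\<exists>\<epsilon>>0. \<forall>x\<in>{0..<\<epsilon>}. \<phi> x = - 2 * \<alpha> * x powr \<alpha>) \<and>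
    (\<forall>X \<X> \<tau>. first_return_scheme (manneville_pomeau \<alpha>) X \<X> \<tau> \<longrightarrow>
      \<not> (\<exists>\<mu>. equilibrium_state (manneville_pomeau \<alpha>) \<phi> \<mu> \<and>
             compatible (manneville_pomeau \<alpha>) X \<X> \<tau> \<mu>))"
proof -
  note \<alpha> = assms(1,2) and b = assms(3)
  have b0: "b < 0" using b ln_gt_zero[of 2] by linarith
  have "eventually (\<lambda>N. exp b * renewal_bound b (2 / \<alpha>) N 0 < 1 \<and> 1 \<le> N) sequentially"
    using eventually_renewal_bound_0[OF b] eventually_ge_at_top[of 1] by (rule eventually_conj)
  then obtain N where N: "exp b * renewal_bound b (2 / \<alpha>) N 0 < 1" "1 \<le> N"
    using eventually_happens'[OF sequentially_bot] by blast
  define \<phi> where "\<phi> = potential \<alpha> b N"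
  show ?thesis
  proof (intro exI[of _ \<phi>] conjI allI impI notI)
    show "holder_on {0..1} \<phi>" unfolding \<phi>_def by (rule potential_holder[OF \<alpha> b0])
    show "(SUP x\<in>{0..1}. \<phi> x) - (INF x\<in>{0..1}. \<phi> x) = \<bar>b\<bar>"
      unfolding \<phi>_def by (rule potential_oscillation[OF \<alpha>(1) b0])
    show "\<exists>\<epsilon>>0. \<forall>x\<in>{0..<\<epsilon>}. \<phi> x = - 2 * \<alpha> * x powr \<alpha>"
      using potential_near_0[OF \<alpha> b N(2)] cutoff_bounds(1)[OF \<alpha>(1), of N]
      by (intro exI[of _ "cutoff \<alpha> N / 2"]) (auto simp: \<phi>_def)
  next
    fix X \<X> \<tau>
    assume scheme: "first_return_scheme (manneville_pomeau \<alpha>) X \<X> \<tau>"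
      and "\<exists>\<mu>. equilibrium_state (manneville_pomeau \<alpha>) \<phi> \<mu> \<and>
             compatible (manneville_pomeau \<alpha>) X \<X> \<tau> \<mu>"
    then obtain \<mu> where eq: "equilibrium_state (manneville_pomeau \<alpha>) \<phi> \<mu>"
      and comp: "compatible (manneville_pomeau \<alpha>) X \<X> \<tau> \<mu>" by blast
    let ?R = "right_branch \<alpha> \<inter> I01"
    have M: "prob_space \<mu>" "sets \<mu> = sets (restrict_space borel I01)"
      "manneville_pomeau \<alpha> \<in> measurable \<mu> \<mu>" "distr \<mu> \<mu> (manneville_pomeau \<alpha>) = \<mu>"
      using eq by (auto simp: equilibrium_state_def ergodic_measures_def)
    interpret prob_space \<mu> by (rule M(1))
    have "0 \<le> free_energy (manneville_pomeau \<alpha>) \<phi> \<mu>"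
      using eq pressure_potential_nonneg[OF \<alpha>(1) b0, of N] by (simp add: equilibrium_state_def \<phi>_def)
    also have "\<dots> \<le> ereal (ln (exp b * renewal_bound b (2 / \<alpha>) N 0) * measure \<mu> ?R)"
      unfolding \<phi>_def by (rule free_energy_potential_le[OF \<alpha> b M])
    finally have "0 \<le> ln (exp b * renewal_bound b (2 / \<alpha>) N 0) * measure \<mu> ?R" by simp
    moreover have "ln (exp b * renewal_bound b (2 / \<alpha>) N 0) < 0"
      using N(1) renewal_bound_ge_1[OF b0, of "2 / \<alpha>" N 0] \<alpha> by (intro ln_less_zero) auto
    ultimately have "measure \<mu> ?R = 0"
      using measure_nonneg[of \<mu> ?R] by (simp add: zero_le_mult_iff)
    then have "emeasure \<mu> ?R = 0" by (simp add: emeasure_eq_measure)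
    then have "emeasure \<mu> {0<..<1} = 0"
      by (rule invariant_measure_right_branch_null[OF \<alpha>(1) M(2-4)])
    moreover have "emeasure \<mu> X \<le> emeasure \<mu> {0<..<1}"
      using first_return_scheme_base[OF scheme] M(2)
      by (intro emeasure_mono) (auto simp: sets_restrict_space_iff)
    ultimately show False using comp by (simp add: compatible_def)
  qed
qed

end
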